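(* Let $p\in(2,6]$ and let $\mathcal G$ be a compact connected metric graph of total length $\ell=|\mathcal G|$. For $\mu>0$ let $\kappa_\mu:=\sqrt{\mu/\ell}$, regarded as a constant function on $\mathcal G$. Then there exists $\mu_2=\mu_2(\mathcal G,p)>0$ such that for every $\mu\in(0,\mu_2)$, $\kappa_\mu$ is a ground state of $E$ in $H^1_\mu(\mathcal G)$, i.e. $E(\kappa_\mu)=\inf_{u\in H^1_\mu(\mathcal G)}E(u)$.
   Context: A compact metric graph $\mathcal G$ is formed by finitely many edges (bounded intervals $I_e=[0,\ell_e]$, $0<\ell_e<\infty$) with some endpoints glued together at vertices; self-loops and multiple edges are allowed. All graphs are connected. $|\mathcal G|=\sum_e\ell_e$ is the total length. A function $u:\mathcal G\to\mathbb C$ has restrictions $u_e$ to the edges; integrals and $L^p(\mathcal G)$ norms $\|\cdot\|_p$ are defined edge by edge with Lebesgue measure. $H^1(\mathcal G)$ is the space of continuous $u:\mathcal G\to\mathbb C$ with $u_e\in H^1(I_e)$ for every edge $e$. For $\mu>0$, $H^1_\mu(\mathcal G)=\{u\in H^1(\mathcal G):\|u\|_2^2=\mu\}$. The energy is $E(u)=\frac12\|u'\|_2^2-\frac1p\|u\|_p^p$. A ground state of mass $\mu$ is a global minimizer of $E$ in $H^1_\mu(\mathcal G)$. *)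

theory Defs
  imports "HOL-Analysis.Analysis"
begin

text \<open>
  The edge \<open>e\<close> is the interval \<open>[0, len G e]\<close>; its endpoint \<open>0\<close> is attached to the vertex
  \<open>src G e\<close> and its endpoint \<open>len G e\<close> to the vertex \<open>tgt G e\<close>. Self-loops and multiple edges
  are allowed. The vertices are the values of \<open>src\<close> and \<open>tgt\<close> on edges, so there are no
  isolated vertices.
\<close>

record ('v, 'e) metric_graph =
  edges :: "'e set"
  src :: "'e \<Rightarrow> 'v"
  tgt :: "'e \<Rightarrow> 'v"
  len :: "'e \<Rightarrow> real"

definition compact_metric_graph :: "('v, 'e) metric_graph \<Rightarrow> bool" where
  "compact_metric_graph G \<longleftrightarrow>
     finite (edges G) \<and> edges G \<noteq> {} \<and> (\<forall>e\<in>edges G. 0 < len G e)"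

definition total_length :: "('v, 'e) metric_graph \<Rightarrow> real" where
  "total_length G = (\<Sum>e\<in>edges G. len G e)"

text \<open>
  Normal forms for the points of the quotient of the disjoint union of the edges by the gluing
  of endpoints: \<open>Inner e x\<close> is used only for \<open>0 < x < len G e\<close>.
\<close>

datatype ('v, 'e) gpoint = Vertex 'v | Inner 'e real

definition edge_point :: "('v, 'e) metric_graph \<Rightarrow> 'e \<Rightarrow> real \<Rightarrow> ('v, 'e) gpoint" where
  "edge_point G e x =
     (if x = 0 then Vertex (src G e) else if x = len G e then Vertex (tgt G e) else Inner e x)"

definition points :: "('v, 'e) metric_graph \<Rightarrow> ('v, 'e) gpoint set" where
  "points G = (\<Union>e\<in>edges G. edge_point G e ` {0..len G e})"

text \<open>The quotient topology, i.e. the final topology for the edge maps.\<close>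

definition graph_topology :: "('v, 'e) metric_graph \<Rightarrow> ('v, 'e) gpoint topology" where
  "graph_topology G = topology (\<lambda>U. U \<subseteq> points G \<and>
     (\<forall>e\<in>edges G. openin (top_of_set {0..len G e}) {x \<in> {0..len G e}. edge_point G e x \<in> U}))"

lemma openin_graph_topology:
  "openin (graph_topology G) U \<longleftrightarrow> U \<subseteq> points G \<and>
     (\<forall>e\<in>edges G. openin (top_of_set {0..len G e}) {x \<in> {0..len G e}. edge_point G e x \<in> U})"
proof -
  let ?P = "\<lambda>U. U \<subseteq> points G \<and>
     (\<forall>e\<in>edges G. openin (top_of_set {0..len G e}) {x \<in> {0..len G e}. edge_point G e x \<in> U})"
  have "istopology ?P"
    unfolding istopology_def
  proof (intro conjI allI impI)
    fix S T assume S: "?P S" and T: "?P T"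
    show "S \<inter> T \<subseteq> points G" using S by blast
    show "\<forall>e\<in>edges G. openin (top_of_set {0..len G e})
            {x \<in> {0..len G e}. edge_point G e x \<in> S \<inter> T}"
    proof
      fix e assume "e \<in> edges G"
      then have "openin (top_of_set {0..len G e})
          ({x \<in> {0..len G e}. edge_point G e x \<in> S} \<inter> {x \<in> {0..len G e}. edge_point G e x \<in> T})"
        using S T by (intro openin_Int) blast+
      moreover have "{x \<in> {0..len G e}. edge_point G e x \<in> S} \<inter> {x \<in> {0..len G e}. edge_point G e x \<in> T}
          = {x \<in> {0..len G e}. edge_point G e x \<in> S \<inter> T}" by blast
      ultimately show "openin (top_of_set {0..len G e})
            {x \<in> {0..len G e}. edge_point G e x \<in> S \<inter> T}" by simp
    qed
  next
    fix K assume K: "Ball K ?P"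
    show "\<Union>K \<subseteq> points G" using K by blast
    show "\<forall>e\<in>edges G. openin (top_of_set {0..len G e})
            {x \<in> {0..len G e}. edge_point G e x \<in> \<Union>K}"
    proof
      fix e assume "e \<in> edges G"
      then have "openin (top_of_set {0..len G e})
          (\<Union>U\<in>K. {x \<in> {0..len G e}. edge_point G e x \<in> U})"
        using K by (intro openin_Union) blast
      moreover have "(\<Union>U\<in>K. {x \<in> {0..len G e}. edge_point G e x \<in> U})
          = {x \<in> {0..len G e}. edge_point G e x \<in> \<Union>K}" by blast
      ultimately show "openin (top_of_set {0..len G e})
            {x \<in> {0..len G e}. edge_point G e x \<in> \<Union>K}" by simp
    qed
  qed
  then show ?thesis
    unfolding graph_topology_def by (simp add: topology_inverse')
qed

text \<open>
  Functions on the graph are total functions on the type of points; only their values on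
  \<open>points G\<close> matter. \<open>restr G u e\<close> is the restriction of \<open>u\<close> to the edge \<open>e\<close>.
\<close>

definition restr :: "('v, 'e) metric_graph \<Rightarrow> (('v, 'e) gpoint \<Rightarrow> complex) \<Rightarrow> 'e \<Rightarrow> real \<Rightarrow> complex" where
  "restr G u e = (\<lambda>x. u (edge_point G e x))"

text \<open>Defined for edgewise families, so that it also applies to the derivative of a function.\<close>

definition Lp_norm :: "('v, 'e) metric_graph \<Rightarrow> real \<Rightarrow> ('e \<Rightarrow> real \<Rightarrow> complex) \<Rightarrow> real" where
  "Lp_norm G p f =
     (\<Sum>e\<in>edges G. \<integral>x. cmod (f e x) powr p \<partial>lebesgue_on {0..len G e}) powr (1 / p)"

definition L2_interval :: "real \<Rightarrow> (real \<Rightarrow> complex) set" where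
  "L2_interval l = {f \<in> borel_measurable (lebesgue_on {0..l}).
     integrable (lebesgue_on {0..l}) (\<lambda>x. (cmod (f x))\<^sup>2)}"

text \<open>
  The test functions \<open>C\<^sub>c\<^sup>1(0,l)\<close>, extended by zero to the real line. As in Brezis, Functional
  Analysis, Sobolev Spaces and Partial Differential Equations, Section 8.2, Sobolev functions on
  an interval are defined by testing against \<open>C\<^sub>c\<^sup>1\<close>. Real-valued test functions suffice, by
  linearity.
\<close>

definition test_function :: "real \<Rightarrow> (real \<Rightarrow> real) \<Rightarrow> bool" where
  "test_function l \<phi> \<longleftrightarrow> \<phi> C1_differentiable_on UNIV \<and>
     (\<exists>K. compact K \<and> K \<subseteq> {0<..<l} \<and> (\<forall>x. x \<notin> K \<longrightarrow> \<phi> x = 0))"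

definition has_weak_deriv :: "real \<Rightarrow> (real \<Rightarrow> complex) \<Rightarrow> (real \<Rightarrow> complex) \<Rightarrow> bool" where
  "has_weak_deriv l f g \<longleftrightarrow> g \<in> L2_interval l \<and>
     (\<forall>\<phi>. test_function l \<phi> \<longrightarrow>
        (\<integral>x. f x * of_real (deriv \<phi> x) \<partial>lebesgue_on {0..l}) =
        - (\<integral>x. g x * of_real (\<phi> x) \<partial>lebesgue_on {0..l}))"

definition H1_interval :: "real \<Rightarrow> (real \<Rightarrow> complex) set" where
  "H1_interval l = {f \<in> L2_interval l. \<exists>g. has_weak_deriv l f g}"

text \<open>The weak derivative is unique up to null sets, so integrals do not depend on the choice.\<close>

definition weak_deriv :: "real \<Rightarrow> (real \<Rightarrow> complex) \<Rightarrow> real \<Rightarrow> complex" where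
  "weak_deriv l f = (SOME g. has_weak_deriv l f g)"

definition graph_deriv :: "('v, 'e) metric_graph \<Rightarrow> (('v, 'e) gpoint \<Rightarrow> complex) \<Rightarrow> 'e \<Rightarrow> real \<Rightarrow> complex" where
  "graph_deriv G u e = weak_deriv (len G e) (restr G u e)"

definition H1 :: "('v, 'e) metric_graph \<Rightarrow> (('v, 'e) gpoint \<Rightarrow> complex) set" where
  "H1 G = {u. continuous_map (graph_topology G) euclidean u \<and>
              (\<forall>e\<in>edges G. restr G u e \<in> H1_interval (len G e))}"

definition H1_mass :: "('v, 'e) metric_graph \<Rightarrow> real \<Rightarrow> (('v, 'e) gpoint \<Rightarrow> complex) set" where
  "H1_mass G \<mu> = {u \<in> H1 G. (Lp_norm G 2 (restr G u))\<^sup>2 = \<mu>}"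

definition energy :: "('v, 'e) metric_graph \<Rightarrow> real \<Rightarrow> (('v, 'e) gpoint \<Rightarrow> complex) \<Rightarrow> real" where
  "energy G p u =
     1 / 2 * (Lp_norm G 2 (graph_deriv G u))\<^sup>2 - 1 / p * Lp_norm G p (restr G u) powr p"

definition ground_state ::
    "('v, 'e) metric_graph \<Rightarrow> real \<Rightarrow> real \<Rightarrow> (('v, 'e) gpoint \<Rightarrow> complex) \<Rightarrow> bool" where
  "ground_state G p \<mu> u \<longleftrightarrow> u \<in> H1_mass G \<mu> \<and> (\<forall>v\<in>H1_mass G \<mu>. energy G p u \<le> energy G p v)"

definition kappa :: "('v, 'e) metric_graph \<Rightarrow> real \<Rightarrow> ('v, 'e) gpoint \<Rightarrow> complex" where
  "kappa G \<mu> = (\<lambda>_. of_real (sqrt (\<mu> / total_length G)))"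

end

theory Submission
  imports Defs
begin

text \<open>
  Write \<open>L\<close> for the total length, \<open>k = sqrt (\<mu> / L)\<close> for the value of the constant function,
  \<open>D\<close> for the squared \<open>L\<^sup>2\<close> norm of \<open>u'\<close>, and let \<open>u\<close> have mass \<open>\<mu>\<close>. The comparison between
  \<open>u\<close> and the constant splits according to whether \<open>\<bar>u\<bar>\<close> exceeds a height \<open>M0\<close> that depends only
  on \<open>p\<close> and \<open>L\<close>.

  If \<open>\<bar>u\<bar> \<le> M0\<close> everywhere (\<open>energy_kappa_le_small_sup\<close>), then Taylor's inequality in the variable
  \<open>\<bar>u\<bar>\<^sup>2\<close> gives, pointwise,
  \<open>\<bar>u\<bar> powr p - k powr p - p/2 * k powr (p-2) * (\<bar>u\<bar>\<^sup>2 - k\<^sup>2) \<le> p (p-1) * M0 powr (p-2) * (\<bar>u\<bar> - k)\<^sup>2\<close>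
  (\<open>powr_gap\<close>). The term linear in \<open>\<bar>u\<bar>\<^sup>2 - k\<^sup>2\<close> integrates to zero by the mass constraint. Since
  \<open>\<bar>u\<bar>\<close> oscillates by at most \<open>sqrt (L D)\<close> on a connected graph (\<open>oscillation_bound\<close>) and \<open>k\<^sup>2\<close> is
  the mean of \<open>\<bar>u\<bar>\<^sup>2\<close>, also \<open>(\<bar>u\<bar> - k)\<^sup>2 \<le> L D\<close> (\<open>deviation_from_mean\<close>). Hence the gain in the
  \<open>p\<close>-term is at most \<open>(p-1) * L\<^sup>2 * M0 powr (p-2) * D\<close>, and \<open>M0\<close> is chosen to make this \<open>D/2\<close>.

  If \<open>M = max \<bar>u\<bar> > M0\<close> (\<open>energy_nonneg_large_sup\<close>), then by Hoelder continuity on the edge that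
  carries the maximum \<open>\<bar>u\<bar> \<ge> M/2\<close> on an interval of length \<open>M\<^sup>2 / (4 D)\<close>, or of the length of the
  shortest edge if that is smaller. The second alternative contradicts the smallness of the mass,
  and the first yields \<open>M^4 \<le> 16 \<mu> D\<close>. As \<open>p \<le> 6\<close>, the integral of \<open>\<bar>u\<bar> powr p\<close> is at most
  \<open>M powr (p-2) * \<mu> \<le> 16 \<mu>\<^sup>2 * M0 powr (p-6) * D \<le> D\<close> for small \<open>\<mu>\<close>. So the energy of \<open>u\<close> is
  nonnegative, while that of the constant is negative.

  Two facts about weak derivatives are needed: a continuous \<open>f\<close> with weak derivative \<open>g\<close> satisfies
  \<open>f x - f 0 = integral {0..x} g\<close> (\<open>weak_FTC\<close>), and the weak derivative of a constant vanishes
  almost everywhere (\<open>weak_deriv_const_AE_zero\<close>), so that the constant has no kinetic energy.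
\<close>

section \<open>Test functions approximating the indicator of an interval\<close>

lemma deriv_pos_part_square: "((\<lambda>y::real. (max 0 y)\<^sup>2) has_real_derivative 2 * max 0 y) (at y)"
proof -
  consider "y < 0" | "y = 0" | "y > 0" by linarith
  then show ?thesis
  proof cases
    case 1
    have "((\<lambda>y::real. 0) has_real_derivative 2 * max 0 y) (at y)"
      using 1 by simp
    then show ?thesis
      by (rule has_field_derivative_transform_within[where d = "-y"]) (use 1 in \<open>auto simp: dist_real_def\<close>)
  next
    case 3
    have "((\<lambda>y::real. y\<^sup>2) has_real_derivative 2 * max 0 y) (at y)"
      using 3 by (auto intro!: derivative_eq_intros)
    then show ?thesis
      by (rule has_field_derivative_transform_within[where d = "y"]) (use 3 in \<open>auto simp: dist_real_def max_def abs_if split: if_splits\<close>)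
  next
    case 2
    have "((\<lambda>h::real. max 0 h) \<longlongrightarrow> max 0 0) (at 0)"
      by (intro tendsto_intros)
    moreover have "(\<lambda>h::real. ((max 0 (0 + h))\<^sup>2 - (max 0 0)\<^sup>2) / h) = (\<lambda>h. max 0 h)"
      by (auto simp: fun_eq_iff max_def power2_eq_square)
    ultimately show ?thesis
      unfolding 2 DERIV_def by simp
  qed
qed

text \<open>
  A \<open>C\<^sup>1\<close> function that rises from 0 to 1 on the unit interval. A linear combination of squared
  positive parts is differentiable term by term, with no polynomial pieces to glue.
\<close>

definition c1_step :: "real \<Rightarrow> real" where
  "c1_step y = 2 * (max 0 y)\<^sup>2 - 4 * (max 0 (y - 1/2))\<^sup>2 + 2 * (max 0 (y - 1))\<^sup>2"

text \<open>
  The derivative of \<open>c1_step\<close>: the hat function of height 2 over the unit interval, with integral 1.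
\<close>

definition bump :: "real \<Rightarrow> real" where
  "bump y = 4 * max 0 y - 8 * max 0 (y - 1/2) + 4 * max 0 (y - 1)"

lemma c1_step_deriv: "(c1_step has_real_derivative bump y) (at y)"
proof -
  have s: "((\<lambda>y::real. (max 0 (y - c))\<^sup>2) has_real_derivative 2 * max 0 (y - c)) (at y)" for c
  proof -
    have "((\<lambda>y. y - c) has_real_derivative 1) (at y)"
      by (auto intro!: derivative_eq_intros)
    from DERIV_chain2[where g = "\<lambda>y. y - c" and x = y, OF deriv_pos_part_square this]
    show ?thesis by simp
  qed
  show ?thesis
    unfolding c1_step_def [abs_def] bump_def
    by (rule derivative_eq_intros s s[of 0, simplified] refl)+ simp
qed

lemma bump_nonneg: "0 \<le> bump y"
  and bump_eq_0: "y \<le> 0 \<or> 1 \<le> y \<Longrightarrow> bump y = 0"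
  by (auto simp: bump_def max_def)

lemma c1_step_eq_0: "y \<le> 0 \<Longrightarrow> c1_step y = 0"
  and c1_step_eq_1: "1 \<le> y \<Longrightarrow> c1_step y = 1"
  by (auto simp: c1_step_def max_def power2_eq_square algebra_simps)

lemma c1_step_mono: "x \<le> y \<Longrightarrow> c1_step x \<le> c1_step y"
  by (rule DERIV_nonneg_imp_nondecreasing) (use c1_step_deriv bump_nonneg in blast)+

lemma c1_step_bounds: "0 \<le> c1_step y" "c1_step y \<le> 1"
  using c1_step_mono[of "min 0 y" y] c1_step_mono[of y "max 1 y"] by (auto simp: c1_step_eq_0 c1_step_eq_1)

lemma continuous_bump: "continuous_on S bump"
  unfolding bump_def [abs_def] by (intro continuous_intros)

lemma continuous_c1_step: "continuous_on S c1_step"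
  unfolding c1_step_def [abs_def] by (intro continuous_intros)

text \<open>
  A test function that rises from 0 to 1 on \<open>[a, a + 1/n]\<close> and falls back to 0 on
  \<open>[b, b + 1/n]\<close>. It tends pointwise to the indicator of \<open>{a<..b}\<close>, and its derivative is an
  approximate identity at \<open>a\<close> minus one at \<open>b\<close>.
\<close>

definition cutoff :: "real \<Rightarrow> real \<Rightarrow> real \<Rightarrow> real \<Rightarrow> real" where
  "cutoff n a b x = c1_step (n * (x - a)) - c1_step (n * (x - b))"

lemma cutoff_deriv:
  "(cutoff n a b has_real_derivative (n * bump (n * (x - a)) - n * bump (n * (x - b)))) (at x)"
proof -
  have s: "((\<lambda>x. c1_step (n * (x - c))) has_real_derivative bump (n * (x - c)) * n) (at x)" for c
    by (rule DERIV_chain2[OF c1_step_deriv]) (auto intro!: derivative_eq_intros)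
  show ?thesis
    unfolding cutoff_def [abs_def] by (rule derivative_eq_intros s)+ simp
qed

lemma deriv_cutoff: "deriv (cutoff n a b) x = n * bump (n * (x - a)) - n * bump (n * (x - b))"
  by (rule DERIV_imp_deriv[OF cutoff_deriv])

lemma test_function_cutoff:
  assumes "0 < a" "a < b" "b + 1 / n < l" "0 < n"
  shows "test_function l (cutoff n a b)"
  unfolding test_function_def
proof
  show "cutoff n a b C1_differentiable_on UNIV"
    unfolding C1_differentiable_on_def
  proof (intro exI conjI ballI)
    show "continuous_on UNIV (\<lambda>x. n * bump (n * (x - a)) - n * bump (n * (x - b)))"
      by (intro continuous_intros continuous_on_compose2[OF continuous_bump[of UNIV]]) auto
  qed (use cutoff_deriv in \<open>auto simp: has_real_derivative_iff_has_vector_derivative\<close>)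
  show "\<exists>K. compact K \<and> K \<subseteq> {0<..<l} \<and> (\<forall>x. x \<notin> K \<longrightarrow> cutoff n a b x = 0)"
  proof (intro exI[of _ "{a..b + 1/n}"] conjI allI impI)
    show "{a..b + 1 / n} \<subseteq> {0<..<l}" using assms by auto
    fix x assume "x \<notin> {a..b + 1/n}"
    then consider "x \<le> a" "x \<le> b" | "x > b + 1/n" "x > a + 1/n" using assms by force
    then show "cutoff n a b x = 0"
    proof cases
      case 1
      then show ?thesis using assms by (simp add: cutoff_def c1_step_eq_0 mult_nonneg_nonpos)
    next
      case 2
      then have "1 \<le> n * (x - a)" "1 \<le> n * (x - b)"
        using assms by (auto simp: field_simps)
      then show ?thesis by (simp add: cutoff_def c1_step_eq_1)
    qed
  qed simp
qed

lemma cutoff_bound: "\<bar>cutoff n a b x\<bar> \<le> 1"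
  using c1_step_bounds[of "n * (x - a)"] c1_step_bounds[of "n * (x - b)"] by (simp add: cutoff_def)

lemma continuous_cutoff: "continuous_on S (cutoff n a b)"
  unfolding cutoff_def [abs_def]
  by (intro continuous_intros continuous_on_compose2[OF continuous_c1_step[of UNIV]]) auto

lemma eventually_real_large: "c > 0 \<Longrightarrow> \<forall>\<^sub>F n in sequentially. 0 < real n \<and> 1 \<le> real n * c"
proof -
  assume c: "c > 0"
  have "\<forall>\<^sub>F n in sequentially. 1 / c \<le> real n"
    using filterlim_real_sequentially unfolding filterlim_at_top by blast
  then show ?thesis
    using eventually_gt_at_top[of 0] by eventually_elim (use c in \<open>auto simp: field_simps\<close>)
qed

lemma cutoff_tendsto:
  assumes "a < b"
  shows "(\<lambda>n. cutoff (real n) a b x) \<longlonglongrightarrow> indicator {a<..b} x"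
proof (rule tendsto_eventually)
  have c1_step: "\<forall>\<^sub>F n in sequentially. c1_step (real n * (x - c)) = (if x > c then 1 else 0)" for c
  proof (cases "x > c")
    case True
    then show ?thesis using eventually_real_large[of "x - c"]
      by (auto elim!: eventually_mono simp: c1_step_eq_1)
  next
    case False
    then show ?thesis by (auto simp: c1_step_eq_0 mult_nonneg_nonpos)
  qed
  show "\<forall>\<^sub>F n in sequentially. cutoff (real n) a b x = indicator {a<..b} x"
    using c1_step[of a] c1_step[of b]
    by eventually_elim (use assms in \<open>auto simp: cutoff_def\<close>)
qed

lemma bump_integral:
  assumes "0 \<le> a" "1 \<le> n * (l - a)" "0 < n"
  shows "(\<integral>x. n * bump (n * (x - a)) \<partial>lebesgue_on {0..l}) = 1"
proof -
  have l: "0 \<le> l" using assms zero_less_mult_iff[of n "l - a"] by linarith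
  have c: "continuous_on {0..l} (\<lambda>x. n * bump (n * (x - a)))"
    by (intro continuous_intros continuous_on_compose2[OF continuous_bump[of UNIV]]) auto
  have s: "((\<lambda>x. c1_step (n * (x - a))) has_real_derivative n * bump (n * (x - a))) (at x within {0..l})" for x
  proof -
    have "((\<lambda>x. c1_step (n * (x - a))) has_real_derivative bump (n * (x - a)) * n) (at x)"
      by (rule DERIV_chain2[OF c1_step_deriv]) (auto intro!: derivative_eq_intros)
    then show ?thesis by (simp add: mult.commute has_field_derivative_at_within)
  qed
  have "((\<lambda>x. n * bump (n * (x - a))) has_integral
      (c1_step (n * (l - a)) - c1_step (n * (0 - a)))) {0..l}"
    using l s by (intro fundamental_theorem_of_calculus)
      (auto simp: has_real_derivative_iff_has_vector_derivative)
  moreover have "c1_step (n * (l - a)) = 1" "c1_step (n * (0 - a)) = 0"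
    using assms by (auto simp: c1_step_eq_1 c1_step_eq_0)
  ultimately show ?thesis
    using lebesgue_integral_eq_integral[OF continuous_imp_integrable_real[OF c]]
    by (simp only: integral_unique) simp
qed

lemma bump_approx_identity:
  fixes f :: "real \<Rightarrow> complex"
  assumes f: "continuous_on {0..l} f" and a: "0 \<le> a" "a < l"
  shows "(\<lambda>n. \<integral>x. f x * of_real (real n * bump (real n * (x - a))) \<partial>lebesgue_on {0..l}) \<longlonglongrightarrow> f a"
proof (rule LIMSEQ_I)
  fix r :: real assume r: "0 < r"
  obtain d where d: "0 < d" "\<And>x. x \<in> {0..l} \<Longrightarrow> dist x a < d \<Longrightarrow> dist (f x) (f a) < r / 2"
    using f a r unfolding continuous_on_iff by (metis atLeastAtMost_iff half_gt_zero less_eq_real_def)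
  have "\<forall>\<^sub>F n in sequentially. 0 < real n \<and> 1 \<le> real n * (l - a)"
       "\<forall>\<^sub>F n in sequentially. 0 < real n \<and> 1 \<le> real n * d"
    using a d by (intro eventually_real_large; simp)+
  then have "\<forall>\<^sub>F n in sequentially.
      norm ((\<integral>x. f x * of_real (real n * bump (real n * (x - a))) \<partial>lebesgue_on {0..l}) - f a) < r"
  proof eventually_elim
    case (elim n)
    let ?k = "\<lambda>x. real n * bump (real n * (x - a))"
    have k: "continuous_on {0..l} ?k"
      by (intro continuous_intros continuous_on_compose2[OF continuous_bump[of UNIV]]) auto
    have k1: "(\<integral>x. ?k x \<partial>lebesgue_on {0..l}) = 1"
      using elim a by (intro bump_integral) auto
    have i1: "integrable (lebesgue_on {0..l}) ?k"
      and i2: "integrable (lebesgue_on {0..l}) (\<lambda>x. f x * of_real (?k x))"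
      and i3: "integrable (lebesgue_on {0..l}) (\<lambda>x. f a * of_real (?k x))"
      by (rule continuous_imp_integrable_real; intro continuous_intros f k)+
    have fa: "(\<integral>x. f a * of_real (?k x) \<partial>lebesgue_on {0..l}) = f a"
      using k1 by (simp add: integral_complex_of_real del: of_real_mult)
    have "norm ((\<integral>x. f x * of_real (?k x) \<partial>lebesgue_on {0..l}) - f a)
        = norm (\<integral>x. f x * of_real (?k x) - f a * of_real (?k x) \<partial>lebesgue_on {0..l})"
      by (simp only: Bochner_Integration.integral_diff[OF i2 i3] fa)
    also have "\<dots> \<le> (\<integral>x. r / 2 * ?k x \<partial>lebesgue_on {0..l})"
    proof (rule Bochner_Integration.integral_norm_bound_integral)
      show "integrable (lebesgue_on {0..l}) (\<lambda>x. r / 2 * ?k x)" using i1 by simp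
      fix x assume "x \<in> space (lebesgue_on {0..l})"
      then have x: "x \<in> {0..l}" by simp
      have k0: "0 \<le> ?k x" by (simp add: bump_nonneg)
      have "norm (f x - f a) * ?k x \<le> r / 2 * ?k x"
      proof (cases "dist x a < d")
        case True
        then show ?thesis using d(2)[OF x True] k0
          by (intro mult_right_mono) (auto simp: dist_norm)
      next
        case False
        then have "x \<le> a \<or> x - a \<ge> d" by (auto simp: dist_real_def)
        then have "real n * (x - a) \<le> 0 \<or> 1 \<le> real n * (x - a)"
        proof
          assume "x - a \<ge> d"
          then have "real n * d \<le> real n * (x - a)" by (intro mult_left_mono) auto
          then show ?thesis using elim by linarith
        qed (simp add: mult_nonneg_nonpos)
        then show ?thesis by (simp add: bump_eq_0)
      qed
      then show "norm (f x * of_real (?k x) - f a * of_real (?k x)) \<le> r / 2 * ?k x"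
        using k0 by (simp only: left_diff_distrib[symmetric] norm_mult norm_of_real abs_of_nonneg)
    qed (use i2 i3 in simp)
    also have "\<dots> = r / 2" using k1 i1 by (simp only: Bochner_Integration.integral_mult_right_zero)
    also have "\<dots> < r" using r by simp
    finally show ?case .
  qed
  then show "\<exists>no. \<forall>n\<ge>no. norm ((\<integral>x. f x * of_real (real n * bump (real n * (x - a))) \<partial>lebesgue_on {0..l}) - f a) < r"
    by (simp add: eventually_sequentially)
qed

section \<open>Weak derivatives on an interval\<close>

lemma L2_interval_integrable:
  assumes "g \<in> L2_interval l"
  shows "integrable (lebesgue_on {0..l}) g"
proof (rule Bochner_Integration.integrable_bound)
  show "integrable (lebesgue_on {0..l}) (\<lambda>x. 1 + (cmod (g x))\<^sup>2)"
    using assms continuous_imp_integrable_real[of 0 l "\<lambda>_. 1::real"]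
    by (auto simp: L2_interval_def)
  show "g \<in> borel_measurable (lebesgue_on {0..l})"
    using assms by (simp add: L2_interval_def)
  have "cmod (g x) \<le> 1 + (cmod (g x))\<^sup>2" for x
    using sum_squares_ge_zero[of "cmod (g x) - 1/2" 0] by (simp add: power2_eq_square algebra_simps)
  then show "AE x in lebesgue_on {0..l}. norm (g x) \<le> norm (1 + (cmod (g x))\<^sup>2)"
    by (intro AE_I2) (simp add: abs_of_nonneg)
qed

text \<open>
  Testing with \<open>cutoff n a b\<close>: as \<open>n\<close> grows, the integral of \<open>f\<close> times the derivative of the test
  function tends to \<open>f a - f b\<close>, and the other side converges by domination.
\<close>

lemma weak_FTC_interior:
  assumes f: "continuous_on {0..l} f" and w: "has_weak_deriv l f g"
    and ab: "0 < a" "a < b" "b < l"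
  shows "(\<integral>x. g x * of_real (indicator {a<..b} x) \<partial>lebesgue_on {0..l}) = f b - f a"
proof -
  let ?M = "lebesgue_on {0..l}"
  have gi: "integrable ?M g"
    using w by (auto simp: has_weak_deriv_def intro: L2_interval_integrable)
  have d: "(\<integral>x. f x * of_real (deriv (cutoff n a b) x) \<partial>?M)
      = (\<integral>x. f x * of_real (n * bump (n * (x - a))) \<partial>?M)
        - (\<integral>x. f x * of_real (n * bump (n * (x - b))) \<partial>?M)" for n
  proof -
    have "integrable ?M (\<lambda>x. f x * of_real (n * bump (n * (x - c))))" for c
      by (intro continuous_imp_integrable_real continuous_intros f
          continuous_on_compose2[OF continuous_bump[of UNIV]]) auto
    then show ?thesis
      by (simp only: deriv_cutoff of_real_diff right_diff_distrib Bochner_Integration.integral_diff)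
  qed
  have L: "(\<lambda>n. \<integral>x. f x * of_real (deriv (cutoff (real n) a b) x) \<partial>?M) \<longlonglongrightarrow> f a - f b"
    unfolding d using ab by (intro tendsto_diff bump_approx_identity f) auto
  have R: "(\<lambda>n. \<integral>x. g x * of_real (cutoff (real n) a b x) \<partial>?M)
      \<longlonglongrightarrow> (\<integral>x. g x * of_real (indicator {a<..b} x) \<partial>?M)"
  proof (rule integral_dominated_convergence[where w = "\<lambda>x. norm (g x)"])
    have gm: "g \<in> borel_measurable ?M" using gi by auto
    show "(\<lambda>x. g x * of_real (indicator {a<..b} x)) \<in> borel_measurable ?M"
    proof -
      have "indicat_real {a<..b} \<in> borel_measurable ?M"
        by (intro measurable_restrict_space1 borel_measurable_indicator) auto
      then show ?thesis using gm by measurable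
    qed
    have "cutoff n a b \<in> borel_measurable ?M" for n
      using continuous_imp_integrable_real[OF continuous_cutoff] by blast
    then show "(\<lambda>x. g x * of_real (cutoff (real n) a b x)) \<in> borel_measurable ?M" for n
      using gm by measurable
    show "integrable ?M (\<lambda>x. norm (g x))" using gi by simp
    show "AE x in ?M. (\<lambda>n. g x * of_real (cutoff (real n) a b x)) \<longlonglongrightarrow> g x * of_real (indicator {a<..b} x)"
      using cutoff_tendsto[OF ab(2)] by (intro AE_I2 tendsto_intros) auto
    show "AE x in ?M. norm (g x * of_real (cutoff (real n) a b x)) \<le> norm (g x)" for n
      using cutoff_bound[of "real n" a b] by (intro AE_I2) (simp add: norm_mult mult_left_le)
  qed
  have "\<forall>\<^sub>F n in sequentially. 0 < real n \<and> 1 \<le> real n * ((l - b) / 2)"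
    using ab by (intro eventually_real_large) simp
  then have "\<forall>\<^sub>F n in sequentially. (\<integral>x. f x * of_real (deriv (cutoff (real n) a b) x) \<partial>?M)
      = - (\<integral>x. g x * of_real (cutoff (real n) a b x) \<partial>?M)"
  proof eventually_elim
    case (elim n)
    then have "1 / real n \<le> (l - b) / 2" by (simp add: field_simps)
    then have "test_function l (cutoff (real n) a b)"
      using elim ab by (intro test_function_cutoff) auto
    then show ?case using w by (auto simp: has_weak_deriv_def)
  qed
  then have "(\<lambda>n. - (\<integral>x. g x * of_real (cutoff (real n) a b x) \<partial>?M)) \<longlonglongrightarrow> f a - f b"
    using L by (simp cong: tendsto_cong)
  moreover have "(\<lambda>n. - (\<integral>x. g x * of_real (cutoff (real n) a b x) \<partial>?M))
      \<longlonglongrightarrow> - (\<integral>x. g x * of_real (indicator {a<..b} x) \<partial>?M)"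
    using R by (intro tendsto_minus)
  ultimately have "- (\<integral>x. g x * of_real (indicator {a<..b} x) \<partial>?M) = f a - f b"
    using LIMSEQ_unique by blast
  then have "(\<integral>x. g x * of_real (indicator {a<..b} x) \<partial>?M) = - (f a - f b)"
    by (metis minus_minus)
  then show ?thesis by simp
qed

text \<open>
  The interior statement says that \<open>f\<close> minus the indefinite integral of \<open>g\<close> is constant on the open
  interval. By continuity it is constant on the closed one.
\<close>

lemma weak_FTC:
  assumes f: "continuous_on {0..l} f" and w: "has_weak_deriv l f g" and x: "x \<in> {0..l}" and l: "0 < l"
  shows "integral {0..x} g = f x - f 0"
proof -
  let ?M = "lebesgue_on {0..l}"
  have gi: "integrable ?M g"
    using w by (auto simp: has_weak_deriv_def intro: L2_interval_integrable)
  then have gHK: "g integrable_on {0..l}"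
    by (intro integrable_on_lebesgue_on) auto
  let ?H = "\<lambda>x. f x - integral {0..x} g"
  have cont: "continuous_on {0..l} ?H"
    by (intro continuous_intros f indefinite_integral_continuous_1 gHK)
  have int: "?H a = ?H b" if ab: "0 < a" "a < b" "b < l" for a b
  proof -
    have "set_integrable lebesgue {0..l} g"
      using gi by (simp add: set_integrable_def integrable_restrict_space)
    then have "set_integrable lebesgue {a<..b} g"
      by (rule set_integrable_subset) (use ab in auto)
    then have gab: "integrable (lebesgue_on {a<..b}) g"
      by (simp add: set_integrable_def integrable_restrict_space)
    have "f b - f a = (\<integral>x. g x * of_real (indicator {a<..b} x) \<partial>?M)"
      using weak_FTC_interior[OF f w ab] by simp
    also have "\<dots> = (\<integral>x. g x \<partial>lebesgue_on {a<..b})"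
    proof -
      have "(\<integral>x. g x * of_real (indicator {a<..b} x) \<partial>?M)
        = (\<integral>x. indicator {0..l} x *\<^sub>R (g x * of_real (indicator {a<..b} x)) \<partial>lebesgue)"
        by (simp add: integral_restrict_space)
      also have "\<dots> = (\<integral>x. indicator {a<..b} x *\<^sub>R g x \<partial>lebesgue)"
        by (rule Bochner_Integration.integral_cong) (use ab in \<open>auto simp: indicator_def\<close>)
      also have "\<dots> = (\<integral>x. g x \<partial>lebesgue_on {a<..b})"
        by (simp add: integral_restrict_space)
      finally show ?thesis .
    qed
    also have "\<dots> = integral {a<..b} g"
      using gab by (simp add: lebesgue_integral_eq_integral)
    also have "\<dots> = integral {a..b} g"
      by (rule integral_subset_negligible) (use ab in \<open>auto intro: negligible_subset[of "{a}"]\<close>)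
    also have "\<dots> = integral {0..b} g - integral {0..a} g"
      using Henstock_Kurzweil_Integration.integral_combine[of 0 a b g] ab integrable_on_subinterval[OF gHK, of 0 b]
      by (simp add: algebra_simps)
    finally show ?thesis by (simp add: algebra_simps)
  qed
  have inner: "?H y = ?H (l / 2)" if "y \<in> {0<..<l}" for y
  proof (cases y "l/2" rule: linorder_cases)
    case less
    then show ?thesis using that l by (intro int) auto
  next
    case greater
    then show ?thesis using that l by (intro int[symmetric]) auto
  qed (simp only:)
  have clo: "closure {0<..<l} = {0..l}" using l by (simp add: closure_greaterThanLessThan)
  have "?H y = ?H (l / 2)" if "y \<in> {0..l}" for y
  proof (rule continuous_constant_on_closure[of "{0<..<l}" ?H])
    show "continuous_on (closure {0<..<l}) ?H" unfolding clo by (rule cont)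
    show "y \<in> closure {0<..<l}" unfolding clo by (rule that)
  qed (rule inner)
  from this[OF x] this[of 0] l have "?H x = ?H 0" by simp
  then show ?thesis by (simp add: algebra_simps)
qed

text \<open>
  The sets over which \<open>g\<close> integrates to zero form a Dynkin system that contains the intervals, hence
  all Borel sets, and up to null sets all Lebesgue sets.
\<close>

lemma AE_zero_if_interval_integrals_zero:
  fixes g :: "real \<Rightarrow> complex"
  assumes gi: "integrable (lebesgue_on {0..l}) g"
    and zero: "\<And>x. x \<in> {0..l} \<Longrightarrow> integral {0..x} g = 0"
  shows "AE x in lebesgue_on {0..l}. g x = 0"
proof -
  let ?h = "\<lambda>x. indicator {0..l} x *\<^sub>R g x"
  have hi: "integrable lebesgue ?h"
    using gi by (simp add: integrable_restrict_space)
  have gHK: "g integrable_on {0..l}"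
    using gi by (intro integrable_on_lebesgue_on) auto
  have hA: "set_integrable lebesgue A ?h" if "A \<in> sets lebesgue" for A
    using integrable_mult_indicator[OF that hi] by (simp add: set_integrable_def)
  have h0: "(LINT x:{a..b}|lebesgue. ?h x) = 0" for a b
  proof -
    let ?a = "max 0 a" and ?b = "min l b"
    have "(LINT x:{a..b}|lebesgue. ?h x) = (LINT x:{?a..?b}|lebesgue. ?h x)"
      unfolding set_lebesgue_integral_def
      by (rule Bochner_Integration.integral_cong) (auto simp: indicator_def)
    also have "\<dots> = integral {?a..?b} ?h"
      by (intro set_lebesgue_integral_eq_integral(2) hA) auto
    also have "\<dots> = integral {?a..?b} g"
      by (rule Henstock_Kurzweil_Integration.integral_cong) (auto simp: indicator_def)
    also have "\<dots> = 0"
    proof (cases "?a \<le> ?b")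
      case True
      then have "integral {0..?a} g + integral {?a..?b} g = integral {0..?b} g"
        by (intro Henstock_Kurzweil_Integration.integral_combine integrable_on_subinterval[OF gHK]) auto
      then show ?thesis using True zero[of ?a] zero[of ?b] by auto
    qed simp
    finally show ?thesis .
  qed
  have borel: "(LINT x:A|lebesgue. ?h x) = 0" if "A \<in> sets borel" for A
    using that
  proof (induction rule: borel_set_induct)
    case (interval a b)
    then show ?case using h0 by blast
  next
    case (compl A)
    have "(LINT x:UNIV|lebesgue. ?h x) = 0"
    proof -
      have "(LINT x:UNIV|lebesgue. ?h x) = (LINT x:{0..l}|lebesgue. ?h x)"
        unfolding set_lebesgue_integral_def
        by (rule Bochner_Integration.integral_cong) (auto simp: indicator_def)
      then show ?thesis using h0 by simp
    qed
    moreover have "(LINT x:A \<union> -A|lebesgue. ?h x) = (LINT x:A|lebesgue. ?h x) + (LINT x:-A|lebesgue. ?h x)"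
      using compl by (intro set_integral_Un hA) auto
    ultimately show ?case using compl by simp
  next
    case (union f)
    have "(LINT x:(\<Union>i. f i)|lebesgue. ?h x) = (\<Sum>i. (LINT x:f i|lebesgue. ?h x))"
      using union by (intro lebesgue_integral_countable_add hA) (auto simp: disjoint_family_on_def)
    then show ?case using union by simp
  qed (simp add: set_lebesgue_integral_def)
  interpret finite_measure "lebesgue_on {0..l}"
    by (rule finite_measure_lebesgue_on) simp
  show ?thesis
  proof (rule density_zero[OF gi])
    fix A assume "A \<in> sets (lebesgue_on {0..l})"
    then have A: "A \<in> sets lebesgue" by (auto simp: sets_restrict_space)
    then obtain S N N' where S: "A = S \<union> N" "N \<subseteq> N'" "N' \<in> null_sets lborel" "S \<in> sets lborel"
      using sets_completionE by blast
    have N': "AE x in lebesgue. x \<notin> N'"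
      using S(3) by (intro AE_not_in) (rule null_sets_completionI)
    have "(LINT x:A|lebesgue_on {0..l}. g x) = (LINT x:A|lebesgue. ?h x)"
      by (simp add: set_integral_restrict_space)
    also have "\<dots> = (LINT x:S|lebesgue. ?h x)"
      unfolding set_lebesgue_integral_def
    proof (rule integral_cong_AE)
      show "AE x in lebesgue. indicator A x *\<^sub>R ?h x = indicator S x *\<^sub>R ?h x"
        using N' by eventually_elim (use S in \<open>auto simp: indicator_def\<close>)
      show "(\<lambda>x. indicator A x *\<^sub>R ?h x) \<in> borel_measurable lebesgue"
        using hA[OF A] unfolding set_integrable_def by (rule borel_measurable_integrable)
      have "S \<in> sets lebesgue" using S by auto
      from hA[OF this] show "(\<lambda>x. indicator S x *\<^sub>R ?h x) \<in> borel_measurable lebesgue"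
        unfolding set_integrable_def by (rule borel_measurable_integrable)
    qed
    also have "\<dots> = 0" using borel S by simp
    finally show "(LINT x:A|lebesgue_on {0..l}. g x) = 0" .
  qed
qed

lemma has_weak_deriv_const:
  assumes l: "0 < l"
  shows "has_weak_deriv l (\<lambda>_. c) (\<lambda>_. 0)"
  unfolding has_weak_deriv_def
proof (intro conjI allI impI)
  show "(\<lambda>_. 0) \<in> L2_interval l" by (simp add: L2_interval_def)
  fix \<phi> assume "test_function l \<phi>"
  then obtain K where C1: "\<phi> C1_differentiable_on UNIV"
    and K: "K \<subseteq> {0<..<l}" "\<And>x. x \<notin> K \<Longrightarrow> \<phi> x = 0"
    by (auto simp: test_function_def)
  from C1 obtain D where D: "\<And>x. (\<phi> has_vector_derivative D x) (at x)" "continuous_on UNIV D"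
    by (auto simp: C1_differentiable_on_def)
  have "deriv \<phi> x = D x" for x
    using D(1)[of x] by (intro DERIV_imp_deriv) (simp add: has_real_derivative_iff_has_vector_derivative)
  then have dD: "deriv \<phi> = D" by auto
  have Dc: "continuous_on {0..l} D" using D(2) continuous_on_subset by blast
  have "(D has_integral (\<phi> l - \<phi> 0)) {0..l}"
    using l D(1) by (intro fundamental_theorem_of_calculus) (auto intro: has_vector_derivative_at_within)
  moreover have "\<phi> l = 0" "\<phi> 0 = 0" using K by (auto intro!: K(2))
  ultimately have "(\<integral>x. D x \<partial>lebesgue_on {0..l}) = 0"
    using lebesgue_integral_eq_integral[OF continuous_imp_integrable_real[OF Dc]]
    by (simp add: integral_unique)
  then show "(\<integral>x. c * of_real (deriv \<phi> x) \<partial>lebesgue_on {0..l})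
      = - (\<integral>x. 0 * of_real (\<phi> x) \<partial>lebesgue_on {0..l})"
    by (simp add: dD integral_complex_of_real)
qed

lemma weak_deriv_const_AE_zero:
  assumes l: "0 < l" and w: "has_weak_deriv l (\<lambda>_. c) g"
  shows "AE x in lebesgue_on {0..l}. g x = 0"
proof (rule AE_zero_if_interval_integrals_zero)
  show "integrable (lebesgue_on {0..l}) g"
    using w by (auto simp: has_weak_deriv_def intro: L2_interval_integrable)
  show "integral {0..x} g = 0" if "x \<in> {0..l}" for x
    using weak_FTC[OF _ w that l] by simp
qed

section \<open>Hoelder continuity\<close>

lemma integral_const_interval:
  "a \<le> b \<Longrightarrow> (\<integral>x. c \<partial>lebesgue_on {a..b}) = (b - a) * (c :: real)"
  using lebesgue_integral_eq_integral[OF continuous_imp_integrable_real[of a b "\<lambda>_. c"]] by simp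

lemma integral_square_le_length:
  assumes xy: "x \<le> y" and v: "integrable (lebesgue_on {x..y}) v"
    and v2: "integrable (lebesgue_on {x..y}) (\<lambda>t. (v t)\<^sup>2)"
  shows "(\<integral>t. v t \<partial>lebesgue_on {x..y})\<^sup>2 \<le> (y - x) * (\<integral>t. (v t)\<^sup>2 \<partial>lebesgue_on {x..y} :: real)"
proof (cases "x = y")
  case True
  have "(\<integral>t. v t \<partial>lebesgue_on {x..y}) = integral {x..y} v"
    by (intro lebesgue_integral_eq_integral v) simp
  then show ?thesis using True by simp
next
  case False
  then have d: "0 < y - x" using xy by simp
  let ?M = "lebesgue_on {x..y}"
  let ?I = "\<integral>t. v t \<partial>?M" and ?J = "\<integral>t. (v t)\<^sup>2 \<partial>?M"
  define c where "c = ?I / (y - x)"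
  have ci: "integrable ?M (\<lambda>t. k)" for k :: real
    by (rule continuous_imp_integrable_real) simp
  have cM: "measure ?M {x..y} = y - x" using integral_const_interval[OF xy, of 1] by simp
  \<comment> \<open>\<open>c\<close> is the mean of \<open>v\<close>, and the inequality is the nonnegativity of its variance\<close>
  have "0 \<le> (\<integral>t. (v t - c)\<^sup>2 \<partial>?M)" by simp
  also have "(\<lambda>t. (v t - c)\<^sup>2) = (\<lambda>t. (v t)\<^sup>2 - 2 * c * v t + c\<^sup>2)"
    by (auto simp: power2_eq_square algebra_simps)
  also have "(\<integral>t. (v t)\<^sup>2 - 2 * c * v t + c\<^sup>2 \<partial>?M) = ?J - 2 * c * ?I + (y - x) * c\<^sup>2"
    using v v2 ci by (simp add: cM)
  also have "\<dots> = ?J - ?I\<^sup>2 / (y - x)"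
  proof -
    have "(y - x) * c = ?I" using d by (simp add: c_def)
    then have "(y - x) * c\<^sup>2 = c * ?I" by (simp add: power2_eq_square mult.assoc[symmetric])
    moreover have "c * ?I = ?I\<^sup>2 / (y - x)" by (simp add: c_def power2_eq_square)
    ultimately show ?thesis by simp
  qed
  finally show ?thesis using d by (simp add: pos_divide_le_eq mult.commute)
qed

lemma weak_deriv_Holder:
  assumes f: "continuous_on {0..l} f" and w: "has_weak_deriv l f g"
    and xy: "0 \<le> x" "x \<le> y" "y \<le> l" and l: "0 < l"
  shows "(cmod (f y - f x))\<^sup>2 \<le> (y - x) * (\<integral>t. (cmod (g t))\<^sup>2 \<partial>lebesgue_on {0..l})"
proof -
  have gL: "g \<in> L2_interval l" using w by (simp add: has_weak_deriv_def)
  have gi: "integrable (lebesgue_on {0..l}) g" using gL by (rule L2_interval_integrable)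
  have g2: "integrable (lebesgue_on {0..l}) (\<lambda>t. (cmod (g t))\<^sup>2)" using gL by (simp add: L2_interval_def)
  have gHK: "g integrable_on {0..l}"
    using gi by (intro integrable_on_lebesgue_on) auto
  have gi': "integrable (lebesgue_on {x..y}) g"
    and g2': "integrable (lebesgue_on {x..y}) (\<lambda>t. (cmod (g t))\<^sup>2)"
    using Equivalence_Lebesgue_Henstock_Integration.integrable_subinterval[OF gi, of x y]
      Equivalence_Lebesgue_Henstock_Integration.integrable_subinterval[OF g2, of x y] xy by simp_all
  have "integral {0..x} g + integral {x..y} g = integral {0..y} g"
    using xy by (intro Henstock_Kurzweil_Integration.integral_combine integrable_on_subinterval[OF gHK]) auto
  then have "f y - f x = integral {x..y} g"
    using weak_FTC[OF f w, of x] weak_FTC[OF f w, of y] xy l by (auto simp: algebra_simps)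
  also have "\<dots> = (\<integral>t. g t \<partial>lebesgue_on {x..y})"
    using gi' by (simp add: lebesgue_integral_eq_integral)
  finally have "cmod (f y - f x) \<le> (\<integral>t. cmod (g t) \<partial>lebesgue_on {x..y})"
    by simp
  then have "(cmod (f y - f x))\<^sup>2 \<le> (\<integral>t. cmod (g t) \<partial>lebesgue_on {x..y})\<^sup>2"
    by (intro power_mono) auto
  also have "\<dots> \<le> (y - x) * (\<integral>t. (cmod (g t))\<^sup>2 \<partial>lebesgue_on {x..y})"
    using gi' g2' xy by (intro integral_square_le_length) auto
  also have "\<dots> \<le> (y - x) * (\<integral>t. (cmod (g t))\<^sup>2 \<partial>lebesgue_on {0..l})"
  proof (rule mult_left_mono)
    have "integral {x..y} (\<lambda>t. (cmod (g t))\<^sup>2) \<le> integral {0..l} (\<lambda>t. (cmod (g t))\<^sup>2)"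
      using xy g2 g2' by (intro integral_subset_le integrable_on_lebesgue_on) auto
    then show "(\<integral>t. (cmod (g t))\<^sup>2 \<partial>lebesgue_on {x..y}) \<le> (\<integral>t. (cmod (g t))\<^sup>2 \<partial>lebesgue_on {0..l})"
      using g2 g2' by (simp add: lebesgue_integral_eq_integral)
  qed (use xy in simp)
  finally show ?thesis .
qed

section \<open>Oscillation on a connected metric graph\<close>

text \<open>
  The interval between two points of a connected subset of the line lies in that subset, so its
  length is at most the total length of a cover. This replaces paths in the graph in the
  oscillation bound: the image of the graph under \<open>\<bar>u\<bar>\<close> is connected and is covered by the images
  of the edges.
\<close>

lemma connected_interval_cover_diameter:
  fixes S :: "real set"
  assumes S: "connected S" and E: "finite E" and cover: "S \<subseteq> (\<Union>e\<in>E. {m e..m e + d e})"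
    and d: "\<And>e. e \<in> E \<Longrightarrow> 0 \<le> d e" and P: "P \<in> S" "Q \<in> S"
  shows "\<bar>P - Q\<bar> \<le> (\<Sum>e\<in>E. d e)"
proof -
  have *: "Q - P \<le> (\<Sum>e\<in>E. d e)" if "P \<in> S" "Q \<in> S" "P \<le> Q" for P Q
  proof -
    have "{P..Q} \<subseteq> S" using connected_contains_Icc[OF S] that by blast
    then have sub: "{P..Q} \<subseteq> (\<Union>e\<in>E. {m e..m e + d e})" using cover by blast
    have "Q - P = measure lborel {P..Q}" using that by simp
    also have "\<dots> \<le> measure lborel (\<Union>e\<in>E. {m e..m e + d e})"
      using E by (intro measure_mono_fmeasurable sub fmeasurable.finite_UN)
        (auto intro!: fmeasurableI simp: emeasure_lborel_Icc_eq)
    also have "\<dots> \<le> (\<Sum>e\<in>E. measure lborel {m e..m e + d e})"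
      using E by (intro measure_UNION_le) auto
    also have "\<dots> = (\<Sum>e\<in>E. d e)" using d by (intro sum.cong) auto
    finally show ?thesis .
  qed
  show ?thesis using *[of P Q] *[of Q P] P by (cases "P \<le> Q") auto
qed

lemma topspace_graph_topology: "topspace (graph_topology G) = points G"
proof -
  have "openin (graph_topology G) (points G)"
    unfolding openin_graph_topology
  proof (intro conjI ballI)
    fix e assume "e \<in> edges G"
    then have "{x \<in> {0..len G e}. edge_point G e x \<in> points G} = {0..len G e}"
      by (auto simp: points_def)
    then show "openin (top_of_set {0..len G e}) {x \<in> {0..len G e}. edge_point G e x \<in> points G}"
      by simp
  qed simp
  then have "points G \<subseteq> topspace (graph_topology G)" by (rule openin_subset)
  moreover have "topspace (graph_topology G) \<subseteq> points G"
    using openin_topspace[of "graph_topology G"] unfolding openin_graph_topology by blast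
  ultimately show ?thesis by blast
qed

lemma continuous_map_edge_point:
  assumes "e \<in> edges G"
  shows "continuous_map (top_of_set {0..len G e}) (graph_topology G) (edge_point G e)"
  unfolding continuous_map_def topspace_graph_topology
  using assms by (auto simp: openin_graph_topology points_def)

lemma continuous_on_restr:
  assumes "continuous_map (graph_topology G) euclidean u" "e \<in> edges G"
  shows "continuous_on {0..len G e} (restr G u e)"
  using continuous_map_compose[OF continuous_map_edge_point[OF assms(2)] assms(1)]
  by (simp add: restr_def o_def)

lemma image_points: "f ` points G = (\<Union>e\<in>edges G. (\<lambda>x. f (edge_point G e x)) ` {0..len G e})"
  by (auto simp: points_def)

text \<open>
  The squared \<open>L\<^sup>2\<close> norm of the derivative of \<open>u\<close> on the edge \<open>e\<close>.
\<close>

definition edge_energy :: "('v, 'e) metric_graph \<Rightarrow> (('v, 'e) gpoint \<Rightarrow> complex) \<Rightarrow> 'e \<Rightarrow> real" where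
  "edge_energy G u e = (\<integral>x. (cmod (graph_deriv G u e x))\<^sup>2 \<partial>lebesgue_on {0..len G e})"

lemma edge_energy_nonneg: "0 \<le> edge_energy G u e"
  by (simp add: edge_energy_def)

lemma edge_Holder:
  assumes G: "compact_metric_graph G" and u: "u \<in> H1 G" and e: "e \<in> edges G"
    and xy: "x \<in> {0..len G e}" "y \<in> {0..len G e}"
  shows "(cmod (restr G u e x - restr G u e y))\<^sup>2 \<le> \<bar>x - y\<bar> * edge_energy G u e"
proof -
  have l: "0 < len G e" using G e by (auto simp: compact_metric_graph_def)
  have c: "continuous_on {0..len G e} (restr G u e)"
    using u e by (intro continuous_on_restr) (auto simp: H1_def)
  have "\<exists>g. has_weak_deriv (len G e) (restr G u e) g"
    using u e by (auto simp: H1_def H1_interval_def)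
  then have w: "has_weak_deriv (len G e) (restr G u e) (graph_deriv G u e)"
    unfolding graph_deriv_def weak_deriv_def by (rule someI_ex)
  show ?thesis
  proof (cases "x \<le> y")
    case True
    then show ?thesis using weak_deriv_Holder[OF c w, of x y] xy l
      by (auto simp: edge_energy_def norm_minus_commute)
  next
    case False
    then show ?thesis using weak_deriv_Holder[OF c w, of y x] xy l
      by (auto simp: edge_energy_def norm_minus_commute)
  qed
qed

text \<open>
  On each edge \<open>\<bar>u\<bar>\<close> varies by at most \<open>sqrt (len G e * edge_energy G u e)\<close>; these variations are
  added over the edges and estimated by the Cauchy-Schwarz inequality.
\<close>

lemma oscillation_bound:
  assumes G: "compact_metric_graph G" and con: "connected_space (graph_topology G)"
    and u: "u \<in> H1 G" and PQ: "P \<in> points G" "Q \<in> points G"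
  shows "(cmod (u P) - cmod (u Q))\<^sup>2 \<le> total_length G * (\<Sum>e\<in>edges G. edge_energy G u e)"
proof -
  let ?E = "edges G"
  have E: "finite ?E" and pos: "\<And>e. e \<in> ?E \<Longrightarrow> 0 < len G e"
    using G by (auto simp: compact_metric_graph_def)
  have cu: "continuous_map (graph_topology G) euclidean u" using u by (simp add: H1_def)
  have "continuous_map (graph_topology G) euclidean (\<lambda>x. cmod (u x))"
    by (intro continuous_map_norm cu)
  moreover have "connectedin (graph_topology G) (points G)"
    using con connectedin_topspace[of "graph_topology G"] by (simp only: topspace_graph_topology)
  ultimately have "connectedin euclidean ((\<lambda>x. cmod (u x)) ` points G)"
    by (rule connectedin_continuous_map_image)
  then have S: "connected ((\<lambda>x. cmod (u x)) ` points G)" by (simp only: connectedin_iff_connected)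
  define d where "d e = sqrt (len G e) * sqrt (edge_energy G u e)" for e
  have "\<exists>m. (\<lambda>x. cmod (restr G u e x)) ` {0..len G e} \<subseteq> {m..m + d e}" if e: "e \<in> ?E" for e
  proof -
    have "continuous_on {0..len G e} (\<lambda>x. cmod (restr G u e x))"
      using continuous_on_restr[OF cu e] by (intro continuous_intros)
    then have "\<exists>x0\<in>{0..len G e}. \<forall>x\<in>{0..len G e}. cmod (restr G u e x0) \<le> cmod (restr G u e x)"
      using pos[OF e] by (intro continuous_attains_inf) auto
    then obtain x0 where x0: "x0 \<in> {0..len G e}"
      "\<And>x. x \<in> {0..len G e} \<Longrightarrow> cmod (restr G u e x0) \<le> cmod (restr G u e x)"
      by blast
    have "cmod (restr G u e x) \<le> cmod (restr G u e x0) + d e" if x: "x \<in> {0..len G e}" for x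
    proof -
      have "(cmod (restr G u e x - restr G u e x0))\<^sup>2 \<le> \<bar>x - x0\<bar> * edge_energy G u e"
        by (rule edge_Holder[OF G u e x x0(1)])
      also have "\<dots> \<le> len G e * edge_energy G u e"
        using x x0 by (intro mult_right_mono edge_energy_nonneg) auto
      finally have "cmod (restr G u e x - restr G u e x0) \<le> d e"
        unfolding d_def real_sqrt_mult[symmetric] by (rule real_le_rsqrt)
      then show ?thesis using norm_triangle_ineq2[of "restr G u e x" "restr G u e x0"] by linarith
    qed
    then show ?thesis using x0 by (intro exI[of _ "cmod (restr G u e x0)"]) auto
  qed
  then have "\<forall>e\<in>?E. \<exists>m. (\<lambda>x. cmod (restr G u e x)) ` {0..len G e} \<subseteq> {m..m + d e}" by blast
  from bchoice[OF this] obtain m where m: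
    "\<And>e. e \<in> ?E \<Longrightarrow> (\<lambda>x. cmod (restr G u e x)) ` {0..len G e} \<subseteq> {m e..m e + d e}"
    by blast
  have "\<bar>cmod (u P) - cmod (u Q)\<bar> \<le> (\<Sum>e\<in>?E. d e)"
  proof (rule connected_interval_cover_diameter[OF S E])
    show "(\<lambda>x. cmod (u x)) ` points G \<subseteq> (\<Union>e\<in>?E. {m e..m e + d e})"
      unfolding image_points using m unfolding restr_def by (rule UN_mono[OF subset_refl])
    show "0 \<le> d e" if "e \<in> ?E" for e
      using pos[OF that] edge_energy_nonneg[of G u e] by (simp add: d_def)
  qed (use PQ in auto)
  then have "\<bar>cmod (u P) - cmod (u Q)\<bar>\<^sup>2 \<le> (\<Sum>e\<in>?E. d e)\<^sup>2"
    by (intro power_mono) auto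
  also have "\<dots> \<le> (\<Sum>e\<in>?E. (sqrt (len G e))\<^sup>2) * (\<Sum>e\<in>?E. (sqrt (edge_energy G u e))\<^sup>2)"
    unfolding d_def by (rule Cauchy_Schwarz_ineq_sum)
  also have "\<dots> = total_length G * (\<Sum>e\<in>?E. edge_energy G u e)"
    by (simp add: total_length_def edge_energy_nonneg less_imp_le[OF pos])
  finally show ?thesis by simp
qed

section \<open>A second-order inequality for powers\<close>

lemma powr_tangent_le:
  fixes a b r :: real
  assumes "1 < r" "0 \<le> a" "0 \<le> b"
  shows "b powr r - a powr r \<le> r * b powr (r - 1) * (b - a)"
proof -
  consider "b = 0" | "a = 0" "0 < b" | "0 < a" "0 < b" using assms by fastforce
  then show ?thesis
  proof cases
    case 1
    then show ?thesis by simp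
  next
    case 2
    have "b powr r = b powr (r - 1) * b" using 2 by (simp add: powr_diff)
    then show ?thesis using 2 assms mult_right_mono[of 1 r "b powr r"] by simp
  next
    case 3
    have "((\<lambda>x. x powr r) has_real_derivative r * b powr (r - 1)) (at b within {0<..})"
      using 3 by (auto intro!: derivative_eq_intros)
    then have "a powr r - b powr r \<ge> r * b powr (r - 1) * (a - b)"
      using 3 assms powr_convex[of r]
      by (intro convex_on_imp_above_tangent[where A = "{0<..}"]) (auto simp: interior_open)
    then show ?thesis by (simp add: algebra_simps)
  qed
qed

lemma powr_diff_times_square_diff_le:
  fixes p t k M :: real
  assumes p: "2 < p" and tk: "0 \<le> k" "k \<le> t" "t \<le> M"
  shows "(t powr (p - 2) - k powr (p - 2)) * (t\<^sup>2 - k\<^sup>2) \<le> 2 * (p - 1) * M powr (p - 2) * (t - k)\<^sup>2"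
proof -
  have s: "x powr (p - 1) = x powr (p - 2) * x" if "0 \<le> x" for x :: real
    using that powr_mult_base[OF that, of "p - 2"] by (simp add: mult.commute)
  have d0: "k powr (p - 2) \<le> t powr (p - 2)" using tk p by (intro powr_mono2) auto
  have "(t powr (p - 2) - k powr (p - 2)) * (t + k) \<le> (t powr (p - 2) - k powr (p - 2)) * (2 * t)"
    using tk d0 by (intro mult_left_mono) auto
  also have "\<dots> \<le> 2 * (t powr (p - 1) - k powr (p - 1))"
    using tk mult_left_mono[of k t "k powr (p - 2)"] by (simp add: s algebra_simps)
  also have "\<dots> \<le> 2 * ((p - 1) * t powr (p - 2) * (t - k))"
    using powr_tangent_le[of "p - 1" k t] p tk by (simp add: diff_diff_eq)
  also have "\<dots> \<le> 2 * ((p - 1) * M powr (p - 2) * (t - k))"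
    using tk p by (intro mult_left_mono mult_right_mono powr_mono2) auto
  finally have "(t powr (p - 2) - k powr (p - 2)) * (t + k) * (t - k)
      \<le> 2 * ((p - 1) * M powr (p - 2) * (t - k)) * (t - k)"
    using tk by (intro mult_right_mono) auto
  then show ?thesis by (simp add: power2_eq_square algebra_simps)
qed

text \<open>
  The deviation of \<open>t powr p\<close> from its tangent at \<open>k\<close>, as a function of \<open>t\<^sup>2\<close>. Expanding in
  \<open>t\<^sup>2\<close> rather than \<open>t\<close> makes the first-order term a multiple of \<open>t\<^sup>2 - k\<^sup>2\<close>, whose integral
  the mass controls.
\<close>

lemma powr_gap:
  fixes p t k M :: real
  assumes p: "2 < p" and tk: "0 \<le> t" "t \<le> M" "0 \<le> k" "k \<le> M"
  shows "t powr p - k powr p - p / 2 * k powr (p - 2) * (t\<^sup>2 - k\<^sup>2)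
    \<le> p * (p - 1) * M powr (p - 2) * (t - k)\<^sup>2"
proof -
  have s: "(x\<^sup>2) powr r = x powr (2 * r)" if "0 \<le> x" for x r :: real
    using that powr_powr[of x 2 r] powr_numeral[OF that, of "num.Bit0 num.One"] by simp
  have "(t powr (p - 2) - k powr (p - 2)) * (t\<^sup>2 - k\<^sup>2) \<le> 2 * (p - 1) * M powr (p - 2) * (t - k)\<^sup>2"
  proof (cases "k \<le> t")
    case True
    then show ?thesis using powr_diff_times_square_diff_le[OF p] tk by simp
  next
    case False
    then show ?thesis using powr_diff_times_square_diff_le[OF p, of t k M] tk
      by (simp add: power2_commute[of t k]) (simp add: algebra_simps)
  qed
  then have "p / 2 * ((t powr (p - 2) - k powr (p - 2)) * (t\<^sup>2 - k\<^sup>2))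
      \<le> p / 2 * (2 * (p - 1) * M powr (p - 2) * (t - k)\<^sup>2)"
    using p by (intro mult_left_mono) auto
  moreover have "t powr p - k powr p \<le> p / 2 * t powr (p - 2) * (t\<^sup>2 - k\<^sup>2)"
    using powr_tangent_le[of "p/2" "k\<^sup>2" "t\<^sup>2"] p tk by (simp add: s right_diff_distrib)
  moreover have "p / 2 * ((t powr (p - 2) - k powr (p - 2)) * (t\<^sup>2 - k\<^sup>2))
      = p / 2 * t powr (p - 2) * (t\<^sup>2 - k\<^sup>2) - p / 2 * k powr (p - 2) * (t\<^sup>2 - k\<^sup>2)"
    by (simp only: left_diff_distrib right_diff_distrib mult.assoc)
  moreover have "p / 2 * (2 * (p - 1) * M powr (p - 2) * (t - k)\<^sup>2)
      = p * (p - 1) * M powr (p - 2) * (t - k)\<^sup>2"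
    by simp
  ultimately show ?thesis by linarith
qed

section \<open>Integration over a metric graph\<close>

text \<open>
  The integral over the graph of an edgewise family of real functions.
\<close>

definition graph_integral :: "('v, 'e) metric_graph \<Rightarrow> ('e \<Rightarrow> real \<Rightarrow> real) \<Rightarrow> real" where
  "graph_integral G v = (\<Sum>e\<in>edges G. \<integral>x. v e x \<partial>lebesgue_on {0..len G e})"

text \<open>
  Continuity of each member of the family on its closed edge; no matching at the vertices is required.
\<close>

definition edgewise_continuous :: "('v, 'e) metric_graph \<Rightarrow> ('e \<Rightarrow> real \<Rightarrow> real) \<Rightarrow> bool" where
  "edgewise_continuous G v \<longleftrightarrow> (\<forall>e\<in>edges G. continuous_on {0..len G e} (v e))"

lemma edgewise_continuous_integrable:
  "edgewise_continuous G v \<Longrightarrow> e \<in> edges G \<Longrightarrow> integrable (lebesgue_on {0..len G e}) (v e)"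
  by (auto simp: edgewise_continuous_def intro: continuous_imp_integrable_real)

lemma graph_integral_const:
  "compact_metric_graph G \<Longrightarrow> graph_integral G (\<lambda>_ _. c) = total_length G * c"
  unfolding graph_integral_def total_length_def sum_distrib_right
  by (intro sum.cong refl, subst integral_const_interval) (auto simp: compact_metric_graph_def less_imp_le)

lemma graph_integral_mono:
  assumes "edgewise_continuous G v" "edgewise_continuous G w"
    and "\<And>e x. e \<in> edges G \<Longrightarrow> x \<in> {0..len G e} \<Longrightarrow> v e x \<le> w e x"
  shows "graph_integral G v \<le> graph_integral G w"
  unfolding graph_integral_def
  by (intro sum_mono Bochner_Integration.integral_mono) (use assms edgewise_continuous_integrable in auto)

lemma graph_integral_add:
  assumes "edgewise_continuous G v" "edgewise_continuous G w"
  shows "graph_integral G (\<lambda>e x. v e x + w e x) = graph_integral G v + graph_integral G w"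
  unfolding graph_integral_def sum.distrib[symmetric]
  by (intro sum.cong refl Bochner_Integration.integral_add edgewise_continuous_integrable assms)

lemma graph_integral_cmult:
  "graph_integral G (\<lambda>e x. c * v e x) = c * graph_integral G v"
  by (simp add: graph_integral_def sum_distrib_left)

lemma graph_integral_nonneg: "(\<And>e x. 0 \<le> v e x) \<Longrightarrow> 0 \<le> graph_integral G v"
  unfolding graph_integral_def by (intro sum_nonneg) simp

lemma edgewise_continuous_const: "edgewise_continuous G (\<lambda>_ _. c)"
  by (simp add: edgewise_continuous_def)

lemma edgewise_continuous_add:
  "edgewise_continuous G v \<Longrightarrow> edgewise_continuous G w \<Longrightarrow> edgewise_continuous G (\<lambda>e x. v e x + w e x)"
  unfolding edgewise_continuous_def by (auto intro: continuous_intros)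

lemma edgewise_continuous_cmult:
  "edgewise_continuous G v \<Longrightarrow> edgewise_continuous G (\<lambda>e x. c * v e x)"
  unfolding edgewise_continuous_def by (auto intro: continuous_intros)

lemma edgewise_continuous_powr:
  assumes "u \<in> H1 G" "0 < p"
  shows "edgewise_continuous G (\<lambda>e x. cmod (restr G u e x) powr p)"
  unfolding edgewise_continuous_def
proof
  fix e assume "e \<in> edges G"
  then have "continuous_on {0..len G e} (restr G u e)"
    using assms by (intro continuous_on_restr) (auto simp: H1_def)
  then show "continuous_on {0..len G e} (\<lambda>x. cmod (restr G u e x) powr p)"
    using assms by (intro continuous_on_powr' continuous_intros) auto
qed

lemma edgewise_continuous_square:
  assumes "u \<in> H1 G"
  shows "edgewise_continuous G (\<lambda>e x. (cmod (restr G u e x))\<^sup>2)"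
  using edgewise_continuous_powr[OF assms, of 2] by simp

lemma Lp_norm_powr:
  assumes "0 < p"
  shows "Lp_norm G p f powr p = graph_integral G (\<lambda>e x. cmod (f e x) powr p)"
  using graph_integral_nonneg[of "\<lambda>e x. cmod (f e x) powr p" G] assms
  by (simp add: Lp_norm_def graph_integral_def powr_powr)

lemma Lp_norm_2_square: "(Lp_norm G 2 f)\<^sup>2 = graph_integral G (\<lambda>e x. (cmod (f e x))\<^sup>2)"
proof -
  have "0 \<le> Lp_norm G 2 f" by (simp add: Lp_norm_def)
  then show ?thesis using Lp_norm_powr[of 2 G f] by simp
qed

text \<open>
  The squared \<open>L\<^sup>2\<close> norm of the derivative over the whole graph, that is twice the kinetic energy.
\<close>

definition dirichlet :: "('v, 'e) metric_graph \<Rightarrow> (('v, 'e) gpoint \<Rightarrow> complex) \<Rightarrow> real" where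
  "dirichlet G u = (\<Sum>e\<in>edges G. edge_energy G u e)"

lemma dirichlet_nonneg: "0 \<le> dirichlet G u"
  by (simp add: dirichlet_def sum_nonneg edge_energy_nonneg)

lemma energy_eq:
  assumes "0 < p"
  shows "energy G p u = dirichlet G u / 2 - graph_integral G (\<lambda>e x. cmod (restr G u e x) powr p) / p"
  using assms
  by (simp add: energy_def Lp_norm_powr Lp_norm_2_square dirichlet_def edge_energy_def)
    (simp add: graph_integral_def)

lemma H1_mass_iff:
  "u \<in> H1_mass G \<mu> \<longleftrightarrow> u \<in> H1 G \<and> graph_integral G (\<lambda>e x. (cmod (restr G u e x))\<^sup>2) = \<mu>"
  by (simp add: H1_mass_def Lp_norm_2_square)

lemma total_length_pos: "compact_metric_graph G \<Longrightarrow> 0 < total_length G"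
  unfolding total_length_def compact_metric_graph_def by (intro sum_pos) auto

lemma const_in_H1:
  assumes G: "compact_metric_graph G"
  shows "(\<lambda>_. c) \<in> H1 G"
  unfolding H1_def H1_interval_def
proof (intro CollectI conjI ballI)
  fix e assume e: "e \<in> edges G"
  have l: "0 < len G e" using G e by (simp add: compact_metric_graph_def)
  show "restr G (\<lambda>_. c) e \<in> L2_interval (len G e)"
    using continuous_imp_integrable_real[of 0 "len G e" "\<lambda>_. (cmod c)\<^sup>2"]
    by (simp add: restr_def L2_interval_def)
  show "\<exists>g. has_weak_deriv (len G e) (restr G (\<lambda>_. c) e) g"
    unfolding restr_def using has_weak_deriv_const[OF l] by blast
qed simp

lemma dirichlet_const:
  assumes G: "compact_metric_graph G"
  shows "dirichlet G (\<lambda>_. c) = 0"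
  unfolding dirichlet_def
proof (intro sum.neutral ballI)
  fix e assume e: "e \<in> edges G"
  have l: "0 < len G e" using G e by (simp add: compact_metric_graph_def)
  have "has_weak_deriv (len G e) (\<lambda>_. c) (weak_deriv (len G e) (\<lambda>_. c))"
    unfolding weak_deriv_def by (rule someI[of "has_weak_deriv (len G e) (\<lambda>_. c)"], rule has_weak_deriv_const[OF l])
  from weak_deriv_const_AE_zero[OF l this]
  have "AE x in lebesgue_on {0..len G e}. (cmod (graph_deriv G (\<lambda>_. c) e x))\<^sup>2 = 0"
    unfolding graph_deriv_def restr_def by eventually_elim simp
  then show "edge_energy G (\<lambda>_. c) e = 0"
    unfolding edge_energy_def by (rule integral_eq_zero_AE)
qed

lemma kappa_mass:
  assumes G: "compact_metric_graph G" and "0 < \<mu>"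
  shows "kappa G \<mu> \<in> H1_mass G \<mu>"
  unfolding H1_mass_iff
proof
  show "kappa G \<mu> \<in> H1 G" unfolding kappa_def by (rule const_in_H1[OF G])
  show "graph_integral G (\<lambda>e x. (cmod (restr G (kappa G \<mu>) e x))\<^sup>2) = \<mu>"
    using total_length_pos[OF G] assms
    by (simp add: kappa_def restr_def graph_integral_const[OF G])
qed

lemma energy_kappa:
  assumes G: "compact_metric_graph G" and "0 < \<mu>" "0 < p"
  shows "energy G p (kappa G \<mu>) = - (total_length G * sqrt (\<mu> / total_length G) powr p) / p"
  using total_length_pos[OF G] assms
  by (simp add: energy_eq kappa_def restr_def graph_integral_const[OF G] dirichlet_const[OF G])

lemma edge_energy_le_dirichlet:
  assumes "compact_metric_graph G" "e \<in> edges G"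
  shows "edge_energy G u e \<le> dirichlet G u"
  unfolding dirichlet_def
  using assms by (intro member_le_sum edge_energy_nonneg) (auto simp: compact_metric_graph_def)

lemma edge_point_in_points:
  "e \<in> edges G \<Longrightarrow> x \<in> {0..len G e} \<Longrightarrow> edge_point G e x \<in> points G"
  unfolding points_def by blast

section \<open>Functions below a fixed height\<close>

text \<open>
  The constant \<open>sqrt (\<mu> / total_length G)\<close> is the quadratic mean of \<open>\<bar>u\<bar>\<close>, hence lies between its
  infimum and its supremum, and every value of \<open>\<bar>u\<bar>\<close> is within the oscillation of it.
\<close>

lemma deviation_from_mean:
  assumes G: "compact_metric_graph G" and con: "connected_space (graph_topology G)"
    and u: "u \<in> H1_mass G \<mu>" and \<mu>: "0 < \<mu>" and P: "P \<in> points G"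
  shows "(cmod (u P) - sqrt (\<mu> / total_length G))\<^sup>2 \<le> total_length G * dirichlet G u"
proof -
  let ?L = "total_length G" and ?k = "sqrt (\<mu> / total_length G)"
  let ?F = "\<lambda>e x. (cmod (restr G u e x))\<^sup>2"
  define \<delta> where "\<delta> = sqrt (?L * dirichlet G u)"
  have L: "0 < ?L" by (rule total_length_pos[OF G])
  have uH: "u \<in> H1 G" and mass: "graph_integral G ?F = \<mu>" using u by (auto simp: H1_mass_iff)
  have k2: "?L * ?k\<^sup>2 = \<mu>" using L \<mu> by simp
  have k: "0 < ?k" using L \<mu> by simp
  have osc: "\<bar>cmod (u P) - cmod (u Q)\<bar> \<le> \<delta>" if "Q \<in> points G" for Q
    using oscillation_bound[OF G con uH P that] unfolding \<delta>_def dirichlet_def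
    by (intro real_le_rsqrt) simp
  have ec: "edgewise_continuous G ?F" by (rule edgewise_continuous_square[OF uH])
  have osc': "\<bar>cmod (u P) - cmod (restr G u e x)\<bar> \<le> \<delta>" if "e \<in> edges G" "x \<in> {0..len G e}" for e x
    unfolding restr_def using that by (intro osc edge_point_in_points)
  have up: "cmod (u P) - ?k \<le> \<delta>"
  proof (rule ccontr)
    assume "\<not> ?thesis"
    then have c: "?k < cmod (u P) - \<delta>" by simp
    then have c0: "0 \<le> cmod (u P) - \<delta>" using k by linarith
    have "graph_integral G (\<lambda>_ _. (cmod (u P) - \<delta>)\<^sup>2) \<le> graph_integral G ?F"
    proof (intro graph_integral_mono edgewise_continuous_const ec power_mono)
      fix e x assume "e \<in> edges G" "x \<in> {0..len G e}"
      then show "cmod (u P) - \<delta> \<le> cmod (restr G u e x)"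
        using osc'[of e x] by linarith
    qed (rule c0)
    then have "?L * (cmod (u P) - \<delta>)\<^sup>2 \<le> ?L * ?k\<^sup>2"
      unfolding graph_integral_const[OF G] mass k2 .
    then have "(cmod (u P) - \<delta>)\<^sup>2 \<le> ?k\<^sup>2" using L by (rule mult_left_le_imp_le)
    then have "cmod (u P) - \<delta> \<le> ?k" by (rule power2_le_imp_le) (rule less_imp_le[OF k])
    then show False using c by linarith
  qed
  have lo: "?k - cmod (u P) \<le> \<delta>"
  proof (rule ccontr)
    assume "\<not> ?thesis"
    then have c: "cmod (u P) + \<delta> < ?k" by simp
    have "graph_integral G ?F \<le> graph_integral G (\<lambda>_ _. (cmod (u P) + \<delta>)\<^sup>2)"
    proof (intro graph_integral_mono edgewise_continuous_const ec power_mono)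
      fix e x assume "e \<in> edges G" "x \<in> {0..len G e}"
      then show "cmod (restr G u e x) \<le> cmod (u P) + \<delta>"
        using osc'[of e x] by linarith
    qed auto
    then have "?L * ?k\<^sup>2 \<le> ?L * (cmod (u P) + \<delta>)\<^sup>2"
      unfolding graph_integral_const[OF G] mass k2 .
    then have "?k\<^sup>2 \<le> (cmod (u P) + \<delta>)\<^sup>2" using L by (rule mult_left_le_imp_le)
    then have "?k \<le> cmod (u P) + \<delta>"
      by (rule power2_le_imp_le) (use osc[OF P] in simp)
    then show False using c by simp
  qed
  have "\<bar>cmod (u P) - ?k\<bar>\<^sup>2 \<le> \<delta>\<^sup>2" using up lo by (intro power_mono) auto
  then show ?thesis using L dirichlet_nonneg[of G u] by (simp add: \<delta>_def)
qed

lemma energy_kappa_le_small_sup: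
  assumes G: "compact_metric_graph G" and con: "connected_space (graph_topology G)"
    and p: "2 < p" and \<mu>: "0 < \<mu>" and u: "u \<in> H1_mass G \<mu>"
    and k: "sqrt (\<mu> / total_length G) \<le> M"
    and M: "\<And>P. P \<in> points G \<Longrightarrow> cmod (u P) \<le> M"
    and small: "2 * (p - 1) * (total_length G)\<^sup>2 * M powr (p - 2) \<le> 1"
  shows "energy G p (kappa G \<mu>) \<le> energy G p u"
proof -
  let ?L = "total_length G" and ?k = "sqrt (\<mu> / total_length G)"
  let ?f = "\<lambda>e x. cmod (restr G u e x)"
  define a where "a = p / 2 * ?k powr (p - 2)"
  define C where "C = p * (p - 1) * M powr (p - 2) * (?L * dirichlet G u)"
  have L: "0 < ?L" by (rule total_length_pos[OF G])
  have p0: "0 < p" using p by simp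
  have uH: "u \<in> H1 G" and mass: "graph_integral G (\<lambda>e x. (?f e x)\<^sup>2) = \<mu>" using u by (auto simp: H1_mass_iff)
  have k2: "?L * ?k\<^sup>2 = \<mu>" using L \<mu> by simp
  have c2: "edgewise_continuous G (\<lambda>e x. (?f e x)\<^sup>2)" by (rule edgewise_continuous_square[OF uH])
  have cp: "edgewise_continuous G (\<lambda>e x. ?f e x powr p)"
    using p by (intro edgewise_continuous_powr[OF uH]) simp
  have "graph_integral G (\<lambda>e x. ?f e x powr p)
      \<le> graph_integral G (\<lambda>e x. a * (?f e x)\<^sup>2 + (?k powr p - a * ?k\<^sup>2 + C))"
  proof (rule graph_integral_mono[OF cp])
    show "edgewise_continuous G (\<lambda>e x. a * (?f e x)\<^sup>2 + (?k powr p - a * ?k\<^sup>2 + C))"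
      by (intro edgewise_continuous_add edgewise_continuous_cmult edgewise_continuous_const c2)
    fix e x assume "e \<in> edges G" "x \<in> {0..len G e}"
    then have pt: "edge_point G e x \<in> points G" by (rule edge_point_in_points)
    have "?f e x powr p - ?k powr p - p / 2 * ?k powr (p - 2) * ((?f e x)\<^sup>2 - ?k\<^sup>2)
        \<le> p * (p - 1) * M powr (p - 2) * (?f e x - ?k)\<^sup>2"
      using M[OF pt] k L \<mu> by (intro powr_gap p) (auto simp: restr_def)
    also have "\<dots> \<le> C"
      unfolding C_def
      using deviation_from_mean[OF G con u \<mu> pt] p by (intro mult_left_mono) (auto simp: restr_def)
    finally show "?f e x powr p \<le> a * (?f e x)\<^sup>2 + (?k powr p - a * ?k\<^sup>2 + C)"
      unfolding a_def[symmetric] right_diff_distrib by linarith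
  qed
  \<comment> \<open>the terms with \<open>a\<close> cancel because \<open>u\<close> and the constant have the same mass\<close>
  also have "\<dots> = a * \<mu> + ?L * (?k powr p - a * ?k\<^sup>2 + C)"
    by (subst graph_integral_add)
      (simp_all only: edgewise_continuous_cmult edgewise_continuous_const c2
        graph_integral_cmult graph_integral_const[OF G] mass)
  also have "\<dots> = ?L * ?k powr p + ?L * C"
  proof -
    have "?L * (a * ?k\<^sup>2) = a * (?L * ?k\<^sup>2)" by (rule mult.left_commute)
    also have "\<dots> = a * \<mu>" by (simp only: k2)
    finally show ?thesis unfolding distrib_left right_diff_distrib by linarith
  qed
  also have "?L * C \<le> p / 2 * dirichlet G u"
  proof -
    have "?L * C = p / 2 * ((2 * (p - 1) * ?L\<^sup>2 * M powr (p - 2)) * dirichlet G u)"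
      by (simp add: C_def power2_eq_square)
    also have "\<dots> \<le> p / 2 * (1 * dirichlet G u)"
      using p small dirichlet_nonneg by (intro mult_left_mono mult_right_mono) auto
    finally show ?thesis by simp
  qed
  finally have "graph_integral G (\<lambda>e x. ?f e x powr p) / p \<le> (?L * ?k powr p + p / 2 * dirichlet G u) / p"
    using p by (intro divide_right_mono) auto
  also have "\<dots> = ?L * ?k powr p / p + dirichlet G u / 2"
    using p by (simp add: field_simps)
  finally show ?thesis
    unfolding energy_kappa[OF G \<mu> p0] energy_eq[OF p0, of G u] by simp
qed

section \<open>Functions with a high maximum\<close>

text \<open>
  If \<open>d * dirichlet G u\<close> is small, then \<open>\<bar>u\<bar>\<close> keeps half of its value at \<open>x0\<close> over an
  interval of length \<open>d\<close> around \<open>x0\<close>, which gives a lower bound for the mass.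
\<close>

lemma mass_near_maximum:
  assumes G: "compact_metric_graph G" and u: "u \<in> H1 G" and e: "e \<in> edges G" and x0: "x0 \<in> {0..len G e}"
    and d: "0 \<le> d" "d \<le> len G e" "d * dirichlet G u \<le> (cmod (restr G u e x0) / 2)\<^sup>2"
  shows "d * (cmod (restr G u e x0) / 2)\<^sup>2 \<le> graph_integral G (\<lambda>e x. (cmod (restr G u e x))\<^sup>2)"
proof -
  let ?f = "\<lambda>x. cmod (restr G u e x)"
  \<comment> \<open>the interval starts at \<open>x0\<close> unless that would overrun the end of the edge\<close>
  define a where "a = min x0 (len G e - d)"
  have a: "0 \<le> a" "a + d \<le> len G e" "a \<le> x0" "x0 \<le> a + d" using d x0 by (auto simp: a_def)
  have half: "(?f x0 / 2)\<^sup>2 \<le> (?f x)\<^sup>2" if x: "x \<in> {a..a + d}" for x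
  proof -
    have "(cmod (restr G u e x0 - restr G u e x))\<^sup>2 \<le> \<bar>x0 - x\<bar> * edge_energy G u e"
      using a x x0 by (intro edge_Holder[OF G u e]) auto
    also have "\<dots> \<le> d * dirichlet G u"
      using a x edge_energy_le_dirichlet[OF G e] d by (intro mult_mono edge_energy_nonneg) auto
    also have "\<dots> \<le> (?f x0 / 2)\<^sup>2" by (rule d)
    finally have "cmod (restr G u e x0 - restr G u e x) \<le> ?f x0 / 2"
      by (rule power2_le_imp_le) simp
    then have "?f x0 / 2 \<le> ?f x" using norm_triangle_ineq2[of "restr G u e x0" "restr G u e x"] by linarith
    then show ?thesis by (intro power_mono) auto
  qed
  have i: "integrable (lebesgue_on {0..len G e}) (\<lambda>x. (?f x)\<^sup>2)"
    by (rule edgewise_continuous_integrable[OF edgewise_continuous_square[OF u] e])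
  have i': "integrable (lebesgue_on {a..a + d}) (\<lambda>x. (?f x)\<^sup>2)"
    using Equivalence_Lebesgue_Henstock_Integration.integrable_subinterval[OF i, of a "a + d"] a by simp
  have "d * (?f x0 / 2)\<^sup>2 = (\<integral>x. (?f x0 / 2)\<^sup>2 \<partial>lebesgue_on {a..a + d})"
    using d by (subst integral_const_interval) auto
  also have "\<dots> \<le> (\<integral>x. (?f x)\<^sup>2 \<partial>lebesgue_on {a..a + d})"
    by (rule Bochner_Integration.integral_mono[OF _ i'])
      (use half in \<open>auto intro!: continuous_imp_integrable_real\<close>)
  also have "\<dots> = integral {a..a + d} (\<lambda>x. (?f x)\<^sup>2)"
    by (intro lebesgue_integral_eq_integral i') simp
  also have "\<dots> \<le> integral {0..len G e} (\<lambda>x. (?f x)\<^sup>2)"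
    using a i i' by (intro integral_subset_le integrable_on_lebesgue_on) auto
  also have "\<dots> = (\<integral>x. (?f x)\<^sup>2 \<partial>lebesgue_on {0..len G e})"
    by (intro lebesgue_integral_eq_integral[symmetric] i) simp
  also have "\<dots> \<le> graph_integral G (\<lambda>e x. (cmod (restr G u e x))\<^sup>2)"
    unfolding graph_integral_def
    using G e by (intro member_le_sum[of e "edges G" "\<lambda>e. \<integral>x. (cmod (restr G u e x))\<^sup>2 \<partial>lebesgue_on {0..len G e}"])
      (auto simp: compact_metric_graph_def)
  finally show ?thesis .
qed

lemma attains_maximum:
  assumes G: "compact_metric_graph G" and u: "u \<in> H1 G"
  obtains e x where "e \<in> edges G" "x \<in> {0..len G e}" "\<And>P. P \<in> points G \<Longrightarrow> cmod (u P) \<le> cmod (restr G u e x)"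
proof -
  let ?S = "(\<lambda>P. cmod (u P)) ` points G"
  have c: "continuous_on {0..len G e} (\<lambda>x. cmod (restr G u e x))" if "e \<in> edges G" for e
    using that u by (intro continuous_intros continuous_on_restr) (auto simp: H1_def)
  have "compact ?S"
    unfolding image_points
    using G c by (intro compact_UN compact_continuous_image) (auto simp: compact_metric_graph_def restr_def)
  moreover have "?S \<noteq> {}"
  proof -
    obtain e where "e \<in> edges G" "0 < len G e"
      using G by (auto simp: compact_metric_graph_def)
    then show ?thesis using edge_point_in_points[of e G 0] by auto
  qed
  ultimately have "\<exists>m\<in>?S. \<forall>t\<in>?S. t \<le> m" by (rule compact_attains_sup)
  then obtain m where m: "m \<in> ?S" "\<forall>t\<in>?S. t \<le> m" by (rule bexE)
  from m(1) obtain e x where ex: "e \<in> edges G" "x \<in> {0..len G e}" "m = cmod (restr G u e x)"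
    unfolding image_points restr_def by (elim UN_E imageE)
  show ?thesis
  proof (rule that[OF ex(1,2)])
    show "cmod (u P) \<le> cmod (restr G u e x)" if "P \<in> points G" for P
      unfolding ex(3)[symmetric] using m(2) that by (rule bspec[OF _ imageI])
  qed
qed

text \<open>
  The hypothesis \<open>p \<le> 6\<close> enters here: after extracting \<open>M^4 \<le> 16 * \<mu> * dirichlet G u\<close> from
  \<open>M powr (p - 2)\<close>, the remaining factor \<open>M powr (p - 6)\<close> is nonincreasing in \<open>M\<close>.
\<close>

lemma energy_nonneg_large_sup:
  assumes G: "compact_metric_graph G" and p: "2 < p" "p \<le> 6" and \<mu>: "0 < \<mu>" and u: "u \<in> H1_mass G \<mu>"
    and e: "e \<in> edges G" and x0: "x0 \<in> {0..len G e}"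
    and max: "\<And>P. P \<in> points G \<Longrightarrow> cmod (u P) \<le> cmod (restr G u e x0)"
    and M0: "0 < M0" "M0 < cmod (restr G u e x0)"
    and s: "\<And>e. e \<in> edges G \<Longrightarrow> s \<le> len G e" "0 < s"
    and \<mu>1: "\<mu> < s * (M0 / 2)\<^sup>2" and \<mu>2: "16 * \<mu>\<^sup>2 \<le> M0 powr (6 - p)"
  shows "0 \<le> energy G p u"
proof -
  define M where "M = cmod (restr G u e x0)"
  define D where "D = dirichlet G u"
  let ?f = "\<lambda>e x. cmod (restr G u e x)"
  have M: "0 < M" "M0 < M" using M0 by (auto simp: M_def)
  have D0: "0 \<le> D" by (simp add: D_def dirichlet_nonneg)
  have uH: "u \<in> H1 G" and mass: "graph_integral G (\<lambda>e x. (?f e x)\<^sup>2) = \<mu>" using u by (auto simp: H1_mass_iff)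
  have near: "d * (M / 2)\<^sup>2 \<le> \<mu>" if "0 \<le> d" "d \<le> len G e" "d * D \<le> (M / 2)\<^sup>2" for d
    using mass_near_maximum[OF G uH e x0, of d] that by (simp add: M_def D_def mass)
  \<comment> \<open>otherwise \<open>\<bar>u\<bar> \<ge> M/2\<close> on an interval of length \<open>s\<close>, which carries more mass than \<open>\<mu>\<close>\<close>
  have sD: "(M / 2)\<^sup>2 < s * D"
  proof (rule ccontr)
    assume "\<not> ?thesis"
    then have "s * (M / 2)\<^sup>2 \<le> \<mu>" using s e by (intro near) auto
    moreover have "s * (M0 / 2)\<^sup>2 \<le> s * (M / 2)\<^sup>2"
      using s M M0 by (intro mult_left_mono power_mono) auto
    ultimately show False using \<mu>1 by linarith
  qed
  have Dpos: "0 < D"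
  proof (rule ccontr)
    assume "\<not> 0 < D"
    then have "D = 0" using D0 by simp
    then show False using sD zero_le_power2[of "M / 2"] by simp
  qed
  have "(M / 2)\<^sup>2 / D * (M / 2)\<^sup>2 \<le> \<mu>"
  proof (rule near)
    have "(M / 2)\<^sup>2 / D \<le> s" using sD Dpos by (simp add: pos_divide_le_eq)
    then show "(M / 2)\<^sup>2 / D \<le> len G e" using s(1)[OF e] by linarith
  qed (use Dpos in auto)
  then have M4: "M ^ 4 \<le> 16 * \<mu> * D"
    using Dpos by (simp add: field_simps power2_eq_square power4_eq_xxxx)
  have "graph_integral G (\<lambda>e x. ?f e x powr p) \<le> graph_integral G (\<lambda>e x. M powr (p - 2) * (?f e x)\<^sup>2)"
  proof (rule graph_integral_mono)
    show "edgewise_continuous G (\<lambda>e x. ?f e x powr p)"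
      using p by (intro edgewise_continuous_powr[OF uH]) simp
    show "edgewise_continuous G (\<lambda>e x. M powr (p - 2) * (?f e x)\<^sup>2)"
      by (intro edgewise_continuous_cmult edgewise_continuous_square[OF uH])
    fix e x assume "e \<in> edges G" "x \<in> {0..len G e}"
    then have "edge_point G e x \<in> points G" by (rule edge_point_in_points)
    from max[OF this] have fM: "?f e x \<le> M" by (simp add: M_def restr_def)
    have "?f e x powr p = ?f e x powr (p - 2) * ?f e x powr 2"
      by (simp only: powr_add[symmetric]) simp
    also have "\<dots> \<le> M powr (p - 2) * (?f e x)\<^sup>2"
      using fM p by (simp add: mult_right_mono powr_mono2)
    finally show "?f e x powr p \<le> M powr (p - 2) * (?f e x)\<^sup>2" .
  qed
  also have "\<dots> = M powr (p - 2) * \<mu>" by (simp add: graph_integral_cmult mass)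
  also have "M powr (p - 2) = M powr (p - 6) * M ^ 4"
  proof -
    have "M ^ 4 = M powr 4" using M by simp
    then show ?thesis by (simp only: powr_add[symmetric]) simp
  qed
  also have "M powr (p - 6) * M ^ 4 * \<mu> \<le> M0 powr (p - 6) * (16 * \<mu> * D) * \<mu>"
    using M M0 p \<mu> M4 by (intro mult_right_mono mult_mono powr_mono2') auto
  also have "\<dots> = (M0 powr (p - 6) * (16 * \<mu>\<^sup>2)) * D" by (simp add: power2_eq_square)
  also have "\<dots> \<le> 1 * D"
  proof (rule mult_right_mono)
    have "M0 powr (p - 6) * (16 * \<mu>\<^sup>2) \<le> M0 powr (p - 6) * M0 powr (6 - p)"
      using \<mu>2 by (intro mult_left_mono) auto
    also have "\<dots> = 1" using M0 by (simp add: powr_add[symmetric])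
    finally show "M0 powr (p - 6) * (16 * \<mu>\<^sup>2) \<le> 1" .
  qed (rule D0)
  finally have I: "graph_integral G (\<lambda>e x. ?f e x powr p) \<le> D" by simp
  have "graph_integral G (\<lambda>e x. ?f e x powr p) / p \<le> D / p"
    using I p by (intro divide_right_mono) auto
  also have "D / p \<le> D / 2" using D0 p by (intro divide_left_mono) auto
  finally show ?thesis using p by (simp add: energy_eq D_def)
qed

section \<open>The constant function is a ground state\<close>

theorem theorem2p2:
  fixes G :: "('v, 'e) metric_graph" and p :: real
  assumes "2 < p" and "p \<le> 6"
    and "compact_metric_graph G"
    and "connected_space (graph_topology G)"
  shows "\<exists>\<mu>2>0. \<forall>\<mu>. 0 < \<mu> \<and> \<mu> < \<mu>2 \<longrightarrow>
           ground_state G p \<mu> (kappa G \<mu>) \<and>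
           energy G p (kappa G \<mu>) = (INF u\<in>H1_mass G \<mu>. energy G p u)"
proof -
  note p = assms(1,2) and G = assms(3) and con = assms(4)
  let ?L = "total_length G"
  have L: "0 < ?L" by (rule total_length_pos[OF G])
  define s where "s = Min (len G ` edges G)"
  have s: "s \<le> len G e" if "e \<in> edges G" for e
    using G that by (auto simp: s_def compact_metric_graph_def)
  have s0: "0 < s" using G by (auto simp: s_def compact_metric_graph_def)
  \<comment> \<open>the height for which the estimate of \<open>energy_kappa_le_small_sup\<close> is exactly absorbed\<close>
  define M0 where "M0 = (1 / (2 * (p - 1) * ?L\<^sup>2)) powr (1 / (p - 2))"
  have M0: "0 < M0" using L p by (simp add: M0_def)
  have small: "2 * (p - 1) * ?L\<^sup>2 * M0 powr (p - 2) \<le> 1"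
    using L p by (simp add: M0_def powr_powr)
  \<comment> \<open>the three bounds give \<open>k \<le> M0\<close>, exclude a high plateau over the shortest edge, and make
    \<open>16 * \<mu>\<^sup>2 \<le> M0 powr (6 - p)\<close>\<close>
  define \<mu>2 where "\<mu>2 = min (?L * M0\<^sup>2) (min (s * (M0 / 2)\<^sup>2) (sqrt (M0 powr (6 - p)) / 4))"
  have "0 < \<mu>2" using L M0 s0 by (simp add: \<mu>2_def)
  moreover have "ground_state G p \<mu> (kappa G \<mu>) \<and>
      energy G p (kappa G \<mu>) = (INF u\<in>H1_mass G \<mu>. energy G p u)" if \<mu>: "0 < \<mu>" "\<mu> < \<mu>2" for \<mu>
  proof -
    have b: "\<mu> < ?L * M0\<^sup>2" "\<mu> < s * (M0 / 2)\<^sup>2" "\<mu> < sqrt (M0 powr (6 - p)) / 4"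
      using \<mu> by (auto simp: \<mu>2_def)
    have "(4 * \<mu>)\<^sup>2 \<le> (sqrt (M0 powr (6 - p)))\<^sup>2"
      using b(3) \<mu> by (intro power_mono) auto
    then have b3: "16 * \<mu>\<^sup>2 \<le> M0 powr (6 - p)" by simp
    have k: "sqrt (\<mu> / ?L) \<le> M0"
      using b(1) L M0 by (intro real_le_lsqrt) (auto simp: pos_divide_le_eq mult.commute)
    have min: "energy G p (kappa G \<mu>) \<le> energy G p u" if u: "u \<in> H1_mass G \<mu>" for u
    proof -
      have uH: "u \<in> H1 G" using u by (simp add: H1_mass_iff)
      obtain e x where ex: "e \<in> edges G" "x \<in> {0..len G e}"
        "\<And>P. P \<in> points G \<Longrightarrow> cmod (u P) \<le> cmod (restr G u e x)"
        using attains_maximum[OF G uH] by blast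
      show ?thesis
      proof (cases "cmod (restr G u e x) \<le> M0")
        case True
        then have "cmod (u P) \<le> M0" if "P \<in> points G" for P using ex(3)[OF that] by linarith
        then show ?thesis by (rule energy_kappa_le_small_sup[OF G con p(1) \<mu>(1) u k _ small])
      next
        case False
        then have "0 \<le> energy G p u"
          by (intro energy_nonneg_large_sup[OF G p \<mu>(1) u ex M0 _ s s0 b(2) b3]) auto
        moreover have "energy G p (kappa G \<mu>) \<le> 0"
          using L p \<mu> by (simp add: energy_kappa[OF G])
        ultimately show ?thesis by linarith
      qed
    qed
    have kap: "kappa G \<mu> \<in> H1_mass G \<mu>" by (rule kappa_mass[OF G \<mu>(1)])
    have "(INF u\<in>H1_mass G \<mu>. energy G p u) = energy G p (kappa G \<mu>)"
      using kap min by (intro cInf_eq_minimum) auto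
    then show ?thesis using kap min by (simp add: ground_state_def)
  qed
  ultimately show ?thesis by blast
qed

end
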